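(* Let $\lambda_1,\lambda_2\ge1$ and $\ell\ge0$ be integers and let $D\subset\mathbb{C}$ be an open set. (i) For any $g\in SL(2,\mathbb{C})$ such that $D\subset g\cdot D$, one has, as maps $\mathcal{O}(D\times D)\to\mathcal{O}(D)$, $$\varpi_{\lambda_1+\lambda_2+2\ell}(g)\circ\mathrm{RC}_{\lambda_1,\lambda_2}^{(\ell)}=\mathrm{RC}_{\lambda_1,\lambda_2}^{(\ell)}\circ(\varpi_{\lambda_1}(g)\boxtimes\varpi_{\lambda_2}(g)).$$ (ii) Equivalently, at the infinitesimal level, for any $Z=\begin{pmatrix}p&q\\ r&-p\end{pmatrix}\in\mathfrak{sl}(2,\mathbb{C})$, one has, as maps $\mathcal{O}(D\times D)\to\mathcal{O}(D)$, $$d\varpi_{\lambda_1+\lambda_2+2\ell}(Z)\circ\mathrm{RC}_{\lambda_1,\lambda_2}^{(\ell)}=\mathrm{RC}_{\lambda_1,\lambda_2}^{(\ell)}\circ(d\varpi_{\lambda_1}(Z)\boxtimes\mathrm{id}+\mathrm{id}\boxtimes d\varpi_{\lambda_2}(Z)),$$ where $$d\varpi_{\lambda}(Z)=-\lambda(p-rz)-(2pz+q-rz^2)\frac{d}{dz}.$$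
   Context: $\mathcal{O}(\cdot)$ denotes the space of holomorphic functions. $SL(2,\mathbb{C})$ acts by Möbius transformations $g\cdot z=\frac{az+b}{cz+d}$ for $g=\begin{pmatrix}a&b\\c&d\end{pmatrix}$. If $h\in SL(2,\mathbb{C})$ satisfies $D\subset h\cdot D$ (the image $h\cdot D$ being taken in the Riemann sphere; equivalently $h^{-1}\cdot D\subset D$), write $h^{-1}=\begin{pmatrix}a&b\\c&d\end{pmatrix}$ and define, for $f\in\mathcal{O}(D)$ and $z\in D$, $$(\varpi_\lambda(h)f)(z)=(cz+d)^{-\lambda}f\left(\frac{az+b}{cz+d}\right).$$ For $f\in\mathcal{O}(D\times D)$, $\varpi_{\lambda_1}(h)\boxtimes\varpi_{\lambda_2}(h)$ acts by $\varpi_{\lambda_1}(h)$ in the variable $\zeta_1$ and $\varpi_{\lambda_2}(h)$ in the variable $\zeta_2$: $$((\varpi_{\lambda_1}(h)\boxtimes\varpi_{\lambda_2}(h))f)(\zeta_1,\zeta_2)=(c\zeta_1+d)^{-\lambda_1}(c\zeta_2+d)^{-\lambda_2}f(h^{-1}\cdot\zeta_1,h^{-1}\cdot\zeta_2).$$ Similarly $d\varpi_{\lambda_1}(Z)\boxtimes\mathrm{id}$ and $\mathrm{id}\boxtimes d\varpi_{\lambda_2}(Z)$ are the differential operators acting in $\zeta_1$ only and in $\zeta_2$ only, respectively. Rankin--Cohen bracket: $\mathrm{RC}_{\lambda_1,\lambda_2}^{(\ell)}:\mathcal{O}(D\times D)\to\mathcal{O}(D)$ is $$(\mathrm{RC}_{\lambda_1,\lambda_2}^{(\ell)}f)(z)=\sum_{j=0}^{\ell}(-1)^j\binom{\lambda_1+\ell-1}{j}\binom{\lambda_2+\ell-1}{\ell-j}\left(\frac{\partial^{\ell}f}{\partial\zeta_1^{\ell-j}\,\partial\zeta_2^{j}}\right)(z,z).$$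 *)

theory Defs
  imports "HOL-Complex_Analysis.Complex_Analysis"
begin

unbundle no Formal_Power_Series.fps_syntax

text \<open>The Riemann sphere is \<open>complex option\<close>, with \<open>None\<close> as the point at infinity.\<close>

type_synonym riemann_sphere = "complex option"

definition moebius_transf :: "complex^2^2 \<Rightarrow> complex \<Rightarrow> complex" where
  "moebius_transf g z = (g$1$1 * z + g$1$2) / (g$2$1 * z + g$2$2)"

definition moebius_sphere :: "complex^2^2 \<Rightarrow> riemann_sphere \<Rightarrow> riemann_sphere" where
  "moebius_sphere g p = (case p of
      None \<Rightarrow> if g$2$1 = 0 then None else Some (g$1$1 / g$2$1)
    | Some z \<Rightarrow> if g$2$1 * z + g$2$2 = 0 then None else Some (moebius_transf g z))"

definition SL2 :: "(complex^2^2) set" where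
  "SL2 = {g. det g = 1}"

definition sl2 :: "(complex^2^2) set" where
  "sl2 = {Z. trace Z = 0}"

definition hol :: "complex set \<Rightarrow> (complex \<Rightarrow> complex) set" where
  "hol D = {f. f holomorphic_on D}"

text \<open>Holomorphy in two variables is complex Frechet differentiability: the derivative at each
  point exists and is complex linear, i.e. of the form \<open>(h, k) \<mapsto> a h + b k\<close>.\<close>

definition hol2 :: "(complex \<times> complex) set \<Rightarrow> (complex \<times> complex \<Rightarrow> complex) set" where
  "hol2 S = {f. \<forall>p\<in>S. \<exists>a b. (f has_derivative (\<lambda>(h, k). a * h + b * k)) (at p within S)}"

text \<open>The entries in \<open>varpi k g\<close> are those of the inverse of \<open>g\<close>.\<close>

definition varpi :: "nat \<Rightarrow> complex^2^2 \<Rightarrow> (complex \<Rightarrow> complex) \<Rightarrow> complex \<Rightarrow> complex" where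
  "varpi k g f z = (let h = matrix_inv g in
     (h$2$1 * z + h$2$2) powi (- int k) * f (moebius_transf h z))"

definition dvarpi :: "nat \<Rightarrow> complex^2^2 \<Rightarrow> (complex \<Rightarrow> complex) \<Rightarrow> complex \<Rightarrow> complex" where
  "dvarpi k Z f z = (let p = Z$1$1; q = Z$1$2; r = Z$2$1 in
     - of_nat k * (p - r * z) * f z - (2 * p * z + q - r * z^2) * deriv f z)"

text \<open>\<open>boxtimes A B\<close> lets \<open>A\<close> act in the first variable and \<open>B\<close> in the second.\<close>

definition boxtimes ::
  "((complex \<Rightarrow> complex) \<Rightarrow> complex \<Rightarrow> complex) \<Rightarrow> ((complex \<Rightarrow> complex) \<Rightarrow> complex \<Rightarrow> complex)
    \<Rightarrow> (complex \<times> complex \<Rightarrow> complex) \<Rightarrow> complex \<times> complex \<Rightarrow> complex" (infixr "\<boxtimes>" 70) where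
  "(A \<boxtimes> B) f = (\<lambda>(z1, z2). A (\<lambda>w1. B (\<lambda>w2. f (w1, w2)) z2) z1)"

text \<open>\<open>pderiv2 i j f\<close> is differentiated \<open>i\<close> times in the first variable and \<open>j\<close> times in the
  second.\<close>

definition pderiv2 ::
  "nat \<Rightarrow> nat \<Rightarrow> (complex \<times> complex \<Rightarrow> complex) \<Rightarrow> complex \<times> complex \<Rightarrow> complex" where
  "pderiv2 i j = (deriv ^^ i) \<boxtimes> (deriv ^^ j)"

definition RC ::
  "nat \<Rightarrow> nat \<Rightarrow> nat \<Rightarrow> (complex \<times> complex \<Rightarrow> complex) \<Rightarrow> complex \<Rightarrow> complex" where
  "RC k1 k2 l f z = (\<Sum>j=0..l. (- 1)^j * of_nat ((k1 + l - 1) choose j)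
     * of_nat ((k2 + l - 1) choose (l - j)) * pderiv2 (l - j) j f (z, z))"

lemma boxtimes_varpi:
  fixes g :: "complex^2^2"
  defines "h \<equiv> matrix_inv g"
  shows "(varpi k1 g \<boxtimes> varpi k2 g) f (z1, z2)
    = (h$2$1 * z1 + h$2$2) powi (- int k1) * (h$2$1 * z2 + h$2$2) powi (- int k2)
      * f (moebius_transf h z1, moebius_transf h z2)"
  by (simp add: boxtimes_def varpi_def Let_def h_def)

lemma boxtimes_dvarpi_id:
  "(dvarpi k Z \<boxtimes> id) f (z1, z2) = dvarpi k Z (\<lambda>w1. f (w1, z2)) z1"
  "(id \<boxtimes> dvarpi k Z) f (z1, z2) = dvarpi k Z (\<lambda>w2. f (z1, w2)) z2"
  by (simp_all add: boxtimes_def)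

lemma matrix_inv_SL2:
  fixes g :: "complex^2^2"
  assumes "g \<in> SL2"
  shows "matrix_inv g $ 1 $ 1 = g $ 2 $ 2" "matrix_inv g $ 1 $ 2 = - g $ 1 $ 2"
    "matrix_inv g $ 2 $ 1 = - g $ 2 $ 1" "matrix_inv g $ 2 $ 2 = g $ 1 $ 1"
proof -
  define h :: "complex^2^2" where
    "h = vector [vector [g$2$2, - g$1$2], vector [- g$2$1, g$1$1]]"
  have d: "g$1$1 * g$2$2 - g$1$2 * g$2$1 = 1"
    using assms by (simp add: SL2_def det_2)
  have gh: "g ** h = mat 1"
    unfolding h_def matrix_matrix_mult_def mat_def vec_eq_iff forall_2 sum_2
    using d by (simp add: mult.commute)
  then have hg: "h ** g = mat 1"
    using matrix_left_right_inverse by blast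
  from gh hg have "g ** matrix_inv g = mat 1 \<and> matrix_inv g ** g = mat 1"
    unfolding matrix_inv_def by (rule someI[of "\<lambda>A. g ** A = mat 1 \<and> A ** g = mat 1" h, OF conjI])
  then have "matrix_inv g = h"
    using hg by (metis matrix_mul_assoc[of h g "matrix_inv g"] matrix_mul_lid matrix_mul_rid)
  then show "matrix_inv g $ 1 $ 1 = g $ 2 $ 2" "matrix_inv g $ 1 $ 2 = - g $ 1 $ 2"
    "matrix_inv g $ 2 $ 1 = - g $ 2 $ 1" "matrix_inv g $ 2 $ 2 = g $ 1 $ 1"
    by (simp_all add: h_def)
qed

lemma subset_moebius_sphere_iff:
  fixes g :: "complex^2^2"
  assumes "g \<in> SL2"
  defines "h \<equiv> matrix_inv g"
  shows "Some ` D \<subseteq> moebius_sphere g ` Some ` D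
    \<longleftrightarrow> (\<forall>z\<in>D. h$2$1 * z + h$2$2 \<noteq> 0 \<and> moebius_transf h z \<in> D)"
proof -
  have d: "g$1$1 * g$2$2 - g$1$2 * g$2$1 = 1"
    using assms by (simp add: SL2_def det_2)
  have *: "moebius_sphere g (Some w) = Some z \<longleftrightarrow> h$2$1 * z + h$2$2 \<noteq> 0 \<and> moebius_transf h z = w" for z w
  proof -
    define a b c d' where "a = g$1$1" and "b = g$1$2" and "c = g$2$1" and "d' = g$2$2"
    note abcd = a_def[symmetric] b_def[symmetric] c_def[symmetric] d'_def[symmetric]
    have D: "a * d' - b * c = 1"
      using d by (simp only: abcd)
    have 1: "(a - c * z) * (c * w + d') = 1" if "z * (c * w + d') = a * w + b"
      using that D by algebra
    have 2: "(a - c * z) * (c * w + d') = 1" if "w * (a - c * z) = d' * z - b"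
      using that D by algebra
    have 3: "z * (c * w + d') = a * w + b \<longleftrightarrow> w * (a - c * z) = d' * z - b"
      by algebra
    have "moebius_sphere g (Some w) = Some z \<longleftrightarrow> c * w + d' \<noteq> 0 \<and> z * (c * w + d') = a * w + b"
      by (auto simp: moebius_sphere_def moebius_transf_def abcd nonzero_divide_eq_eq nonzero_eq_divide_eq)
    also have "\<dots> \<longleftrightarrow> a - c * z \<noteq> 0 \<and> w * (a - c * z) = d' * z - b"
      using 1 2 3 by (metis mult_zero_left mult_zero_right zero_neq_one)
    also have "\<dots> \<longleftrightarrow> h$2$1 * z + h$2$2 \<noteq> 0 \<and> moebius_transf h z = w"
    proof -
      have "h$2$1 * z + h$2$2 = a - c * z" "h$1$1 * z + h$1$2 = d' * z - b"
        unfolding h_def matrix_inv_SL2[OF assms(1)] by (simp_all add: abcd)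
      then show ?thesis
        by (auto simp: moebius_transf_def nonzero_divide_eq_eq nonzero_eq_divide_eq)
    qed
    finally show ?thesis .
  qed
  have "Some ` D \<subseteq> moebius_sphere g ` Some ` D
      \<longleftrightarrow> (\<forall>z\<in>D. \<exists>w\<in>D. moebius_sphere g (Some w) = Some z)"
    unfolding image_subset_iff image_image image_iff by metis
  then show ?thesis
    unfolding * by blast
qed

end

theory Submission
  imports Defs
begin

text \<open>
  Both parts compare linear combinations of the mixed derivatives of \<open>f\<close> at a point of the diagonal,
  so each becomes an identity between coefficients as soon as the derivatives of the transformed
  function are known.

  For the group, let \<open>c\<close> and \<open>d\<close> be the lower entries of \<open>g\<^sup>-\<^sup>1\<close>. The \<open>n\<close>th derivative of
  \<open>varpi k g f\<close> is a combination of the functions \<open>varpi (k + n + m) g\<close> applied to the \<open>m\<close>th derivatives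
  of \<open>f\<close>, with coefficients \<open>(n choose m) (k + n - 1)! / (k + m - 1)! (- c)\<^sup>n\<^sup>-\<^sup>m\<close> (\<open>higher_deriv_varpi\<close>).
  Using this in both variables and summing with the coefficients of the bracket, the mixed derivative
  of orders \<open>a, b\<close> gets a factor in which the factorials cancel against the binomial coefficients until
  only the alternating sum of \<open>(l - a - b) choose i\<close> over \<open>i\<close> is left (\<open>sum_rc_coeff_varpi_coeff\<close>). It
  vanishes for \<open>a + b < l\<close>, and the terms with \<open>a + b = l\<close> are the bracket of \<open>f\<close> at the image point
  (\<open>RC_varpi\<close>).

  The infinitesimal part is proved directly and not by differentiating the first part along a
  one-parameter group, since such a group need not map \<open>D\<close> into itself. Passing \<open>n\<close> derivatives through
  \<open>dvarpi k Z\<close> raises the weight to \<open>k + 2 n\<close> and leaves the correction \<open>n (k + n - 1) r\<close> times the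
  derivative of order \<open>n - 1\<close> (\<open>higher_deriv_dvarpi\<close>). In the bracket the weights add up to
  \<open>k1 + k2 + 2 l\<close>, the first-order terms to the derivative along the diagonal, and the corrections
  telescope (\<open>rc_coeff_telescope\<close>, \<open>RC_dvarpi\<close>).

  All this takes for granted that holomorphic functions of two variables have holomorphic and commuting
  partial derivatives. To prove it, they are described as the continuous functions that are holomorphic
  in each variable (\<open>hol2_eq_sep_hol\<close>); for these, Cauchy's integral formula in one variable can be
  differentiated under the integral with respect to the other
  (\<open>has_field_derivative_partial2_integral\<close>, \<open>partial1_partial2_commute\<close>).
\<close>

section \<open>Partial derivatives in two complex variables\<close>

definition partial1 :: "(complex \<times> complex \<Rightarrow> complex) \<Rightarrow> complex \<times> complex \<Rightarrow> complex" where
  "partial1 f = (\<lambda>(z, w). deriv (\<lambda>u. f (u, w)) z)"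

definition partial2 :: "(complex \<times> complex \<Rightarrow> complex) \<Rightarrow> complex \<times> complex \<Rightarrow> complex" where
  "partial2 f = (\<lambda>(z, w). deriv (\<lambda>u. f (z, u)) w)"

lemma funpow_partial1: "(partial1 ^^ n) f (z, w) = (deriv ^^ n) (\<lambda>u. f (u, w)) z"
  by (induction n arbitrary: z) (simp_all add: partial1_def)

lemma funpow_partial2: "(partial2 ^^ n) f (z, w) = (deriv ^^ n) (\<lambda>u. f (z, u)) w"
  by (induction n arbitrary: w) (simp_all add: partial2_def)

lemma pderiv2_eq_funpow: "pderiv2 i j f = (partial1 ^^ i) ((partial2 ^^ j) f)"
  by (simp add: pderiv2_def boxtimes_def fun_eq_iff funpow_partial1 funpow_partial2)

text \<open>Continuity is part of the definition, so Hartogs' theorem is avoided: the set below is easily seen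
to contain all holomorphic functions of two variables, and the converse follows from Cauchy's
integral formula in one variable at a time.\<close>

definition sep_hol :: "complex set \<Rightarrow> complex set \<Rightarrow> (complex \<times> complex \<Rightarrow> complex) set" where
  "sep_hol A B = {f. continuous_on (A \<times> B) f
     \<and> (\<forall>w\<in>B. (\<lambda>z. f (z, w)) holomorphic_on A) \<and> (\<forall>z\<in>A. (\<lambda>w. f (z, w)) holomorphic_on B)}"

lemma sep_hol_swap: "f \<in> sep_hol A B \<Longrightarrow> f \<circ> prod.swap \<in> sep_hol B A"
proof -
  assume f: "f \<in> sep_hol A B"
  have "continuous_on (B \<times> A) (f \<circ> prod.swap)"
    using f by (intro continuous_on_compose continuous_on_swap) (simp add: product_swap sep_hol_def)
  then show ?thesis using f by (auto simp: sep_hol_def)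
qed

text \<open>The Cauchy integral below is taken in the second variable; exchanging the variables transfers what
it gives to the first.\<close>

lemma partial1_swap: "partial1 f = partial2 (f \<circ> prod.swap) \<circ> prod.swap"
  by (simp add: fun_eq_iff partial1_def partial2_def)

lemma DERIV_partial1:
  assumes "f \<in> sep_hol A B" "open A" "z \<in> A" "w \<in> B"
  shows "((\<lambda>u. f (u, w)) has_field_derivative partial1 f (z, w)) (at z)"
  unfolding partial1_def prod.case
  by (rule holomorphic_derivI[OF _ assms(2,3)]) (use assms in \<open>simp add: sep_hol_def\<close>)

lemma DERIV_partial2:
  assumes "f \<in> sep_hol A B" "open B" "z \<in> A" "w \<in> B"
  shows "((\<lambda>v. f (z, v)) has_field_derivative partial2 f (z, w)) (at w)"
  unfolding partial2_def prod.case
  by (rule holomorphic_derivI[OF _ assms(2,4)]) (use assms in \<open>simp add: sep_hol_def\<close>)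

text \<open>The weight in Cauchy's formula for \<open>f' w\<close>, with the derivative of the circle and the factor
\<open>1 / (2 \<pi> \<i>)\<close> already multiplied in, so that the formula becomes a plain integral over \<open>{0..1}\<close>
to which the theorems on parameter integrals apply.\<close>

definition cauchy_kernel :: "complex \<Rightarrow> real \<Rightarrow> complex \<Rightarrow> real \<Rightarrow> complex" where
  "cauchy_kernel c r w t = r * exp (2 * of_real pi * \<i> * t) / (circlepath c r t - w)^2"

lemma deriv_cauchy_kernel:
  assumes "f holomorphic_on S" "cball c r \<subseteq> S" "w \<in> ball c r"
  shows "deriv f w = integral (cbox 0 1) (\<lambda>t. cauchy_kernel c r w t * f (circlepath c r t))"
proof -
  have "deriv f w = 1 / (2 * of_real pi * \<i>) * contour_integral (circlepath c r) (\<lambda>u. f u / (u - w)^2)"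
    using assms(3) holomorphic_on_subset[OF assms(1,2)] holomorphic_on_subset[OF _ ball_subset_cball]
    by (intro DERIV_imp_deriv Cauchy_derivative_integral_circlepath holomorphic_on_imp_continuous_on)
  also have "\<dots> = integral {0..1} (\<lambda>t. 1 / (2 * of_real pi * \<i>) * (f (circlepath c r t) / (circlepath c r t - w)^2
      * (2 * pi * \<i> * r * exp (2 * of_real pi * \<i> * t))))"
    unfolding contour_integral_integral vector_derivative_circlepath by (rule integral_mult_right[symmetric])
  also have "\<dots> = integral (cbox 0 1) (\<lambda>t. cauchy_kernel c r w t * f (circlepath c r t))"
    by (simp add: cauchy_kernel_def field_simps)
  finally show ?thesis .
qed

lemma circlepath_in_sphere: "r \<ge> 0 \<Longrightarrow> circlepath c r t \<in> sphere c r"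
  by (simp add: circlepath dist_norm norm_mult)

lemma continuous_on_circlepath [continuous_intros]:
  "continuous_on S f \<Longrightarrow> continuous_on S (\<lambda>x. circlepath c r (f x))"
  unfolding circlepath by (intro continuous_intros)

lemma continuous_on_cauchy_kernel:
  assumes "r > 0" "continuous_on S w" "continuous_on S t" "w ` S \<subseteq> ball c r"
  shows "continuous_on S (\<lambda>x. cauchy_kernel c r (w x) (t x))"
  unfolding cauchy_kernel_def
proof (intro continuous_intros assms ballI)
  fix x assume "x \<in> S"
  then show "(circlepath c r (t x) - w x)^2 \<noteq> 0"
    using assms(1,4) circlepath_in_sphere[of r c "t x"] by (auto simp: image_subset_iff)
qed

text \<open>Near any point the partial derivative is a Cauchy integral over a fixed circle in the second
variable, whose integrand is jointly continuous in both variables and the parameter of the circle.\<close>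

lemma continuous_on_partial2:
  assumes "open A" "open B" and f: "f \<in> sep_hol A B"
  shows "continuous_on (A \<times> B) (partial2 f)"
proof -
  have "isCont (partial2 f) (z, w)" if zw: "z \<in> A" "w \<in> B" for z w
  proof -
    obtain r where r: "r > 0" "cball w r \<subseteq> B"
      using open_contains_cball_eq[OF \<open>open B\<close>, THEN spec, THEN iffD1, OF zw(2)] by blast
    let ?U = "A \<times> ball w r"
    have fc: "continuous_on (A \<times> B) f" using f by (simp add: sep_hol_def)
    have "continuous_on ?U (\<lambda>p. integral (cbox 0 1)
        (\<lambda>t. cauchy_kernel w r (snd p) t * f (fst p, circlepath w r t)))"
    proof (rule integral_continuous_on_param)
      have c: "circlepath w r t \<in> B" for t
        using r circlepath_in_sphere[of r w t] sphere_cball by force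
      show "continuous_on (?U \<times> cbox 0 1)
          (\<lambda>(p, t). cauchy_kernel w r (snd p) t * f (fst p, circlepath w r t))"
        unfolding split_beta
        using r(1) c by (intro continuous_intros continuous_on_cauchy_kernel
            continuous_on_compose2[OF fc]) auto
    qed
    also have "continuous_on ?U (\<lambda>p. integral (cbox 0 1)
        (\<lambda>t. cauchy_kernel w r (snd p) t * f (fst p, circlepath w r t))) \<longleftrightarrow> continuous_on ?U (partial2 f)"
    proof (rule continuous_on_cong[OF refl])
      fix p assume "p \<in> ?U"
      then obtain a b where p: "p = (a, b)" "a \<in> A" "b \<in> ball w r" by blast
      then have "(\<lambda>u. f (a, u)) holomorphic_on B" using f by (simp add: sep_hol_def)
      from deriv_cauchy_kernel[OF this r(2) p(3)]
      show "integral (cbox 0 1) (\<lambda>t. cauchy_kernel w r (snd p) t * f (fst p, circlepath w r t)) = partial2 f p"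
        unfolding partial2_def p(1) prod.case fst_conv snd_conv by (rule sym)
    qed
    finally have "continuous_on ?U (partial2 f)" .
    then show ?thesis
      using zw r(1) assms(1) continuous_on_interior[of ?U "partial2 f" "(z, w)"]
      by (simp add: interior_open open_Times)
  qed
  then show ?thesis
    by (intro continuous_at_imp_continuous_on) auto
qed

lemma continuous_on_partial1:
  assumes "open A" "open B" "f \<in> sep_hol A B"
  shows "continuous_on (A \<times> B) (partial1 f)"
  unfolding partial1_swap
  using assms by (intro continuous_on_compose continuous_on_swap)
    (simp add: product_swap continuous_on_partial2 sep_hol_swap)

text \<open>Differentiation in \<open>z\<close> under the Cauchy integral for \<open>partial2 f\<close>. Read without the formula for
the value this makes \<open>partial2 f\<close> holomorphic in \<open>z\<close>; the value is itself a Cauchy integral, of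
\<open>partial1 f\<close>, and that is what makes the two partial derivatives commute.\<close>

lemma has_field_derivative_partial2_integral:
  assumes "open A" "open B" and f: "f \<in> sep_hol A B" and zw: "z \<in> A" "w \<in> B"
    and r: "r > 0" "cball w r \<subseteq> B"
  shows "((\<lambda>u. partial2 f (u, w)) has_field_derivative
    integral (cbox 0 1) (\<lambda>t. cauchy_kernel w r w t * partial1 f (z, circlepath w r t))) (at z)"
proof -
  obtain e where e: "e > 0" "ball z e \<subseteq> A"
    using open_contains_ball_eq[OF \<open>open A\<close>, THEN iffD1, OF zw(1)] by blast
  have c: "circlepath w r t \<in> B" for t
    using r circlepath_in_sphere[of r w t] sphere_cball by force
  have fc: "continuous_on (A \<times> B) f" using f by (simp add: sep_hol_def)
  have gc: "continuous_on (A \<times> B) (partial1 f)" by (intro continuous_on_partial1 assms)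
  have der: "((\<lambda>u. integral (cbox 0 1) (\<lambda>t. cauchy_kernel w r w t * f (u, circlepath w r t)))
     has_field_derivative integral (cbox 0 1) (\<lambda>t. cauchy_kernel w r w t * partial1 f (z, circlepath w r t)))
     (at z within ball z e)"
  proof (rule leibniz_rule_field_derivative)
    fix u t assume u: "u \<in> ball z e"
    have "((\<lambda>u. f (u, circlepath w r t)) has_field_derivative partial1 f (u, circlepath w r t)) (at u)"
      using u e c by (intro DERIV_partial1[OF f \<open>open A\<close>]) auto
    then show "((\<lambda>u. cauchy_kernel w r w t * f (u, circlepath w r t)) has_field_derivative
      cauchy_kernel w r w t * partial1 f (u, circlepath w r t)) (at u within ball z e)"
      by (rule has_field_derivative_at_within[OF DERIV_cmult])
  next
    fix u assume u: "u \<in> ball z e"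
    show "(\<lambda>t. cauchy_kernel w r w t * f (u, circlepath w r t)) integrable_on cbox 0 1"
      using r(1) c u e by (intro integrable_continuous continuous_intros continuous_on_cauchy_kernel
            continuous_on_compose2[OF fc]) auto
  next
    show "continuous_on (ball z e \<times> cbox 0 1) (\<lambda>(u, t). cauchy_kernel w r w t * partial1 f (u, circlepath w r t))"
      unfolding split_beta using r(1) c e 
      by (intro continuous_intros continuous_on_cauchy_kernel continuous_on_compose2[OF gc]) auto
  qed (use e in auto)
  show ?thesis
  proof (rule has_field_derivative_transform_within_open[where S = "ball z e"])
    show "((\<lambda>u. integral (cbox 0 1) (\<lambda>t. cauchy_kernel w r w t * f (u, circlepath w r t)))
     has_field_derivative integral (cbox 0 1) (\<lambda>t. cauchy_kernel w r w t * partial1 f (z, circlepath w r t)))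
     (at z)" using der unfolding at_within_open[OF centre_in_ball[THEN iffD2, OF e(1)] open_ball] .
    fix u assume "u \<in> ball z e"
    then show "integral (cbox 0 1) (\<lambda>t. cauchy_kernel w r w t * f (u, circlepath w r t)) = partial2 f (u, w)"
      using f r e by (simp add: partial2_def sep_hol_def deriv_cauchy_kernel[where S = B] subset_iff)
  qed (use e in auto)
qed

lemma sep_hol_partial2:
  assumes "open A" "open B" "f \<in> sep_hol A B"
  shows "partial2 f \<in> sep_hol A B"
proof -
  have "(\<lambda>u. partial2 f (u, w)) holomorphic_on A" if w: "w \<in> B" for w
  proof -
    obtain r where "r > 0" "cball w r \<subseteq> B"
      using open_contains_cball_eq[OF \<open>open B\<close>, THEN spec, THEN iffD1, OF w] by blast
    then show ?thesis
      unfolding holomorphic_on_open[OF \<open>open A\<close>]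
      using has_field_derivative_partial2_integral[OF assms _ w] by blast
  qed
  moreover have "(\<lambda>v. partial2 f (z, v)) holomorphic_on B" if "z \<in> A" for z
    using assms that by (auto simp: partial2_def sep_hol_def intro!: holomorphic_deriv)
  ultimately show ?thesis
    using continuous_on_partial2[OF assms] by (simp add: sep_hol_def)
qed

lemma sep_hol_partial1:
  assumes "open A" "open B" "f \<in> sep_hol A B"
  shows "partial1 f \<in> sep_hol A B"
  unfolding partial1_swap using assms by (intro sep_hol_swap sep_hol_partial2)

text \<open>Both sides equal the Cauchy integral of \<open>partial1 f\<close>. That the right-hand side does needs
\<open>partial1 f\<close> to be holomorphic in the second variable, which is the previous lemma.\<close>

lemma partial1_partial2_commute:
  assumes "open A" "open B" "f \<in> sep_hol A B" "p \<in> A \<times> B"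
  shows "partial1 (partial2 f) p = partial2 (partial1 f) p"
proof -
  obtain z w where p: "p = (z, w)" "z \<in> A" "w \<in> B" using assms(4) by blast
  obtain r where r: "r > 0" "cball w r \<subseteq> B"
    using open_contains_cball_eq[OF \<open>open B\<close>, THEN spec, THEN iffD1, OF p(3)] by blast
  have "partial1 (partial2 f) (z, w)
      = integral (cbox 0 1) (\<lambda>t. cauchy_kernel w r w t * partial1 f (z, circlepath w r t))"
    unfolding partial1_def[of "partial2 f"] prod.case
    by (intro DERIV_imp_deriv has_field_derivative_partial2_integral[of A B]) (use assms p r in auto)
  also have "\<dots> = partial2 (partial1 f) (z, w)"
    unfolding partial2_def prod.case
  proof (rule deriv_cauchy_kernel[symmetric])
    show "(\<lambda>u. partial1 f (z, u)) holomorphic_on B"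
      using sep_hol_partial1[OF assms(1-3)] p by (simp add: sep_hol_def)
  qed (use r in auto)
  finally show ?thesis by (simp add: p)
qed

text \<open>Partial derivatives of which one is continuous give the total derivative; it is complex linear
because both partial derivatives are complex.\<close>

lemma has_derivative_sep_hol:
  assumes "open A" "open B" and f: "f \<in> sep_hol A B" and zw: "z \<in> A" "w \<in> B"
  shows "(f has_derivative (\<lambda>(h, k). partial1 f (z, w) * h + partial2 f (z, w) * k)) (at (z, w))"
proof -
  obtain r where r: "r > 0" "ball w r \<subseteq> B"
    using open_contains_ball_eq[OF \<open>open B\<close>, THEN iffD1, OF zw(2)] by blast
  have "((\<lambda>(u, v). f (u, v)) has_derivative
      (\<lambda>(h, k). partial1 f (z, w) * h + blinfun_mult_right (partial2 f (z, w)) k)) (at (z, w) within A \<times> ball w r)"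
  proof (rule has_derivative_partialsI)
    show "((\<lambda>u. f (u, w)) has_derivative (*) (partial1 f (z, w))) (at z within A)"
      using DERIV_partial1[OF f assms(1) zw] by (simp add: has_field_derivative_def has_derivative_at_withinI)
    show "((\<lambda>v. f (u, v)) has_derivative blinfun_apply (blinfun_mult_right (partial2 f (u, v)))) (at v within ball w r)"
      if "u \<in> A" "v \<in> ball w r" for u v
      using DERIV_partial2[OF f assms(2), of u v] that r
      by (simp add: has_field_derivative_def has_derivative_at_withinI subset_iff)
    have "continuous_on (A \<times> B) (partial2 f)" by (intro continuous_on_partial2 assms)
    then have "continuous_on (A \<times> ball w r) (\<lambda>p. blinfun_mult_right (partial2 f p))"
      using r by (intro bounded_linear.continuous_on[OF bounded_linear_blinfun_mult_right])
        (auto elim: continuous_on_subset)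
    then show "continuous (at (z, w) within A \<times> ball w r) (\<lambda>(u, v). blinfun_mult_right (partial2 f (u, v)))"
      using zw r by (simp add: continuous_on_eq_continuous_within case_prod_beta' del: split_paired_All)
  qed (use r in auto)
  then show ?thesis
    using zw r assms by (simp add: at_within_open[of "(z, w)" "A \<times> ball w r"] open_Times)
qed

text \<open>Osgood's lemma, together with its converse, which only restricts the derivative to each variable.\<close>

lemma hol2_eq_sep_hol:
  assumes "open A" "open B"
  shows "hol2 (A \<times> B) = sep_hol A B"
proof (intro equalityI subsetI)
  fix f assume "f \<in> sep_hol A B"
  from has_derivative_at_withinI[OF has_derivative_sep_hol[OF assms this]]
  show "f \<in> hol2 (A \<times> B)"
    unfolding hol2_def by blast
next
  fix f assume f: "f \<in> hol2 (A \<times> B)"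
  have f': "\<exists>a b. (f has_derivative (\<lambda>(h, k). a * h + b * k)) (at (z, w))" if "z \<in> A" "w \<in> B" for z w
    using f that assms by (force simp: hol2_def at_within_open[OF _ open_Times])
  have "continuous_on (A \<times> B) f"
    using f' by (intro continuous_at_imp_continuous_on) (auto dest: has_derivative_continuous)
  moreover have "(\<lambda>u. f (u, w)) field_differentiable (at z) \<and> (\<lambda>v. f (z, v)) field_differentiable (at w)"
    if zw: "z \<in> A" "w \<in> B" for z w
  proof -
    obtain a b where D: "(f has_derivative (\<lambda>(h, k). a * h + b * k)) (at (z, w))" using f'[OF zw] by blast
    have "((\<lambda>u. (u, w)) has_derivative (\<lambda>h. (h, 0))) (at z)"
      and "((\<lambda>v. (z, v)) has_derivative (\<lambda>k. (0, k))) (at w)"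
      by (auto intro!: derivative_eq_intros)
    from this[THEN has_derivative_compose, OF D]
    show ?thesis
      by (auto simp: field_differentiable_def has_field_derivative_def)
  qed
  ultimately show "f \<in> sep_hol A B"
    by (simp add: sep_hol_def holomorphic_on_def field_differentiable_at_within)
qed

section \<open>Iterated and mixed derivatives\<close>

lemma higher_deriv_cong_open:
  assumes "open S" "z \<in> S" "\<And>w. w \<in> S \<Longrightarrow> f w = g w"
  shows "(deriv ^^ n) f z = (deriv ^^ n) g z"
proof (rule higher_deriv_cong_ev[OF _ refl])
  show "\<forall>\<^sub>F w in nhds z. f w = g w"
    using eventually_nhds_in_open[OF assms(1,2)] by eventually_elim (rule assms(3))
qed

lemma higher_deriv_linear_combination:
  assumes "open S" "z \<in> S" "\<And>i. i \<in> I \<Longrightarrow> G i holomorphic_on S"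
  shows "(deriv ^^ n) (\<lambda>w. \<Sum>i\<in>I. c i * G i w) z = (\<Sum>i\<in>I. c i * (deriv ^^ n) (G i) z)"
  using assms(3)
proof (induction I rule: infinite_finite_induct)
  case (insert x I)
  have "(deriv ^^ n) (\<lambda>w. c x * G x w + (\<Sum>i\<in>I. c i * G i w)) z
      = (deriv ^^ n) (\<lambda>w. c x * G x w) z + (deriv ^^ n) (\<lambda>w. \<Sum>i\<in>I. c i * G i w) z"
    using insert.prems assms(1,2) by (intro higher_deriv_add[where S = S] holomorphic_intros) auto
  also have "(deriv ^^ n) (\<lambda>w. c x * G x w) z = c x * (deriv ^^ n) (G x) z"
    using insert.prems assms(1,2) by (intro higher_deriv_cmult[where A = S]) auto
  finally show ?case using insert by simp
qed simp_all

lemma higher_deriv_cmult_add: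
  assumes "open S" "z \<in> S" "f holomorphic_on S" "g holomorphic_on S"
  shows "(deriv ^^ n) (\<lambda>w. c * f w + g w) z = c * (deriv ^^ n) f z + (deriv ^^ n) g z"
proof -
  have "(deriv ^^ n) (\<lambda>w. c * f w + g w) z = (deriv ^^ n) (\<lambda>w. c * f w) z + (deriv ^^ n) g z"
    using assms by (intro higher_deriv_add[of _ S] holomorphic_on_mult holomorphic_on_const)
  then show ?thesis using assms by (simp add: higher_deriv_cmult[of f S])
qed

lemma sep_hol_funpow_partial1:
  assumes "open A" "open B" "f \<in> sep_hol A B"
  shows "(partial1 ^^ n) f \<in> sep_hol A B"
  using assms by (induction n) (simp_all add: sep_hol_partial1)

lemma sep_hol_funpow_partial2:
  assumes "open A" "open B" "f \<in> sep_hol A B"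
  shows "(partial2 ^^ n) f \<in> sep_hol A B"
  using assms by (induction n) (simp_all add: sep_hol_partial2)

lemma sep_hol_pderiv2:
  assumes "open A" "open B" "f \<in> sep_hol A B"
  shows "pderiv2 i j f \<in> sep_hol A B"
  unfolding pderiv2_eq_funpow using assms by (intro sep_hol_funpow_partial1 sep_hol_funpow_partial2)

lemma sep_hol_holomorphic1: "f \<in> sep_hol A B \<Longrightarrow> w \<in> B \<Longrightarrow> (\<lambda>z. f (z, w)) holomorphic_on A"
  and sep_hol_holomorphic2: "f \<in> sep_hol A B \<Longrightarrow> z \<in> A \<Longrightarrow> (\<lambda>w. f (z, w)) holomorphic_on B"
  by (simp_all add: sep_hol_def)

lemma pderiv2_apply: "pderiv2 i j f (z, w) = (deriv ^^ i) (\<lambda>u. (partial2 ^^ j) f (u, w)) z"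
  by (simp add: pderiv2_eq_funpow funpow_partial1)

lemma partial1_pderiv2: "partial1 (pderiv2 i j f) = pderiv2 (Suc i) j f"
  by (simp add: pderiv2_eq_funpow)

text \<open>In \<open>pderiv2\<close> the derivatives in the second variable are taken first, so a further one has to be
moved past all those in the first variable.\<close>

lemma partial2_pderiv2:
  assumes "open A" "open B" "f \<in> sep_hol A B" "z \<in> A" "w \<in> B"
  shows "partial2 (pderiv2 i j f) (z, w) = pderiv2 i (Suc j) f (z, w)"
  using assms(4)
proof (induction i arbitrary: z)
  case 0
  then show ?case by (simp add: pderiv2_eq_funpow)
next
  case (Suc i)
  have "partial2 (partial1 (pderiv2 i j f)) (z, w) = partial1 (partial2 (pderiv2 i j f)) (z, w)"
    using Suc.prems assms by (intro partial1_partial2_commute[symmetric, of A B] sep_hol_pderiv2) auto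
  also have "\<dots> = partial1 (pderiv2 i (Suc j) f) (z, w)"
    unfolding partial1_def prod.case
    using higher_deriv_cong_open[OF assms(1) Suc.prems Suc.IH, where n = 1] by simp
  finally show ?case by (simp add: partial1_pderiv2)
qed

lemma funpow_partial2_partial1:
  assumes "open A" "open B" "f \<in> sep_hol A B" "z \<in> A" "w \<in> B"
  shows "(partial2 ^^ j) (partial1 f) (z, w) = partial1 ((partial2 ^^ j) f) (z, w)"
  using assms(5)
proof (induction j arbitrary: w)
  case (Suc j)
  have "partial2 ((partial2 ^^ j) (partial1 f)) (z, w) = partial2 (partial1 ((partial2 ^^ j) f)) (z, w)"
    unfolding partial2_def[of "(partial2 ^^ j) (partial1 f)"] partial2_def[of "partial1 ((partial2 ^^ j) f)"] prod.case
    using higher_deriv_cong_open[OF assms(2) Suc.prems Suc.IH, where n = 1] by simp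
  also have "\<dots> = partial1 (partial2 ((partial2 ^^ j) f)) (z, w)"
    using Suc.prems assms by (intro partial1_partial2_commute[symmetric, of A B] sep_hol_funpow_partial2) auto
  finally show ?case by simp
qed simp

lemma pderiv2_add:
  assumes "open A" "open B" "f \<in> sep_hol A B" "g \<in> sep_hol A B" "z \<in> A" "w \<in> B"
  shows "pderiv2 i j (\<lambda>p. f p + g p) (z, w) = pderiv2 i j f (z, w) + pderiv2 i j g (z, w)"
proof -
  have "(partial2 ^^ j) (\<lambda>p. f p + g p) (u, w) = (partial2 ^^ j) f (u, w) + (partial2 ^^ j) g (u, w)"
    if "u \<in> A" for u
    unfolding funpow_partial2 using assms that
    by (intro higher_deriv_add[of _ B] sep_hol_holomorphic2) auto
  then have "pderiv2 i j (\<lambda>p. f p + g p) (z, w)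
      = (deriv ^^ i) (\<lambda>u. (partial2 ^^ j) f (u, w) + (partial2 ^^ j) g (u, w)) z"
    unfolding pderiv2_apply by (intro higher_deriv_cong_open[OF assms(1,5)])
  also have "\<dots> = pderiv2 i j f (z, w) + pderiv2 i j g (z, w)"
    unfolding pderiv2_apply using assms
    by (intro higher_deriv_add[of _ A] sep_hol_holomorphic1[of _ A B] sep_hol_funpow_partial2) auto
  finally show ?thesis .
qed

lemma DERIV_diagonal:
  assumes "open D" "f \<in> sep_hol D D" "z \<in> D"
  shows "((\<lambda>z. f (z, z)) has_field_derivative partial1 f (z, z) + partial2 f (z, z)) (at z)"
proof -
  have "((\<lambda>z. (z, z)) has_derivative (\<lambda>h. (h, h))) (at z)"
    by (auto intro!: derivative_eq_intros)
  from has_derivative_compose[OF this has_derivative_sep_hol[OF assms(1,1,2,3,3)]]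
  show ?thesis
    by (simp add: has_field_derivative_def flip: distrib_right)
qed

lemma sep_hol_mult: "f \<in> sep_hol A B \<Longrightarrow> g \<in> sep_hol A B \<Longrightarrow> (\<lambda>p. f p * g p) \<in> sep_hol A B"
  by (simp add: sep_hol_def continuous_on_mult holomorphic_on_mult)

lemma sep_hol_diff: "f \<in> sep_hol A B \<Longrightarrow> g \<in> sep_hol A B \<Longrightarrow> (\<lambda>p. f p - g p) \<in> sep_hol A B"
  by (simp add: sep_hol_def continuous_on_diff holomorphic_on_diff)

lemma sep_hol_fst:
  assumes "h holomorphic_on A"
  shows "(\<lambda>p. h (fst p)) \<in> sep_hol A B"
  using continuous_on_compose2[OF holomorphic_on_imp_continuous_on[OF assms]
      continuous_on_fst[OF continuous_on_id], of "A \<times> B"] assms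
  by (auto simp: sep_hol_def)

lemma sep_hol_snd:
  assumes "h holomorphic_on B"
  shows "(\<lambda>p. h (snd p)) \<in> sep_hol A B"
  using continuous_on_compose2[OF holomorphic_on_imp_continuous_on[OF assms]
      continuous_on_snd[OF continuous_on_id], of "A \<times> B"] assms
  by (auto simp: sep_hol_def)

section \<open>The Rankin--Cohen bracket\<close>

definition rc_coeff :: "nat \<Rightarrow> nat \<Rightarrow> nat \<Rightarrow> nat \<Rightarrow> complex" where
  "rc_coeff k1 k2 l j = (- 1)^j * of_nat ((k1 + l - 1) choose j) * of_nat ((k2 + l - 1) choose (l - j))"

lemma RC_eq: "RC k1 k2 l f z = (\<Sum>j\<le>l. rc_coeff k1 k2 l j * pderiv2 (l - j) j f (z, z))"
  by (simp add: RC_def rc_coeff_def atLeast0AtMost)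

text \<open>The derivative of the bracket again consists of mixed derivatives on the diagonal, of total order
\<open>l + 1\<close>. It supplies both the holomorphy of the bracket and the first-order part of
\<open>dvarpi k Z (RC k1 k2 l f)\<close>.\<close>

lemma DERIV_RC:
  assumes "open D" "f \<in> sep_hol D D" "z \<in> D"
  shows "(RC k1 k2 l f has_field_derivative (\<Sum>j\<le>l. rc_coeff k1 k2 l j *
    (pderiv2 (Suc (l - j)) j f (z, z) + pderiv2 (l - j) (Suc j) f (z, z)))) (at z)"
proof -
  have "((\<lambda>z. pderiv2 i j f (z, z)) has_field_derivative
      pderiv2 (Suc i) j f (z, z) + pderiv2 i (Suc j) f (z, z)) (at z)" for i j
    using DERIV_diagonal[OF assms(1) sep_hol_pderiv2[OF assms(1,1,2)] assms(3), of i j]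
    by (simp add: partial1_pderiv2 partial2_pderiv2[OF assms(1,1,2,3,3)])
  then show ?thesis
    unfolding RC_eq[abs_def] by (intro DERIV_sum DERIV_cmult)
qed

lemma holomorphic_RC:
  assumes "open D" "f \<in> sep_hol D D"
  shows "RC k1 k2 l f holomorphic_on D"
  unfolding holomorphic_on_open[OF assms(1)] using DERIV_RC[OF assms] by blast

section \<open>Derivatives of the group action\<close>

definition denom :: "complex^2^2 \<Rightarrow> complex \<Rightarrow> complex" where
  "denom g z = matrix_inv g $ 2 $ 1 * z + matrix_inv g $ 2 $ 2"

lemma varpi_eq: "varpi k g f z = inverse (denom g z) ^ k * f (moebius_transf (matrix_inv g) z)"
  by (simp add: varpi_def denom_def Let_def power_int_minus power_inverse)

lemma DERIV_moebius:
  assumes "g \<in> SL2" "denom g z \<noteq> 0"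
  shows "(moebius_transf (matrix_inv g) has_field_derivative inverse (denom g z) ^ 2) (at z)"
proof -
  have d: "matrix_inv g $ 1 $ 1 * matrix_inv g $ 2 $ 2 - matrix_inv g $ 1 $ 2 * matrix_inv g $ 2 $ 1 = 1"
    using assms(1) by (simp add: matrix_inv_SL2 SL2_def det_2 mult.commute)
  define a b c e where "a = matrix_inv g $ 1 $ 1" "b = matrix_inv g $ 1 $ 2"
    "c = matrix_inv g $ 2 $ 1" "e = matrix_inv g $ 2 $ 2"
  note * = this[symmetric]
  have ne: "c * z + e \<noteq> 0" using assms(2) by (simp add: denom_def *)
  have "((\<lambda>z. (a * z + b) / (c * z + e)) has_field_derivative
      (a * (c * z + e) - (a * z + b) * c) / ((c * z + e) * (c * z + e))) (at z)"
    by (auto intro!: derivative_eq_intros ne)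
  also have "a * (c * z + e) - (a * z + b) * c = 1"
    using d unfolding * by algebra
  finally show ?thesis
    by (simp add: moebius_transf_def[abs_def] denom_def * inverse_eq_divide power2_eq_square)
qed

text \<open>The derivative of \<open>varpi k g f\<close> stays in the family: differentiating \<open>f (g\<^sup>-\<^sup>1 z)\<close> brings the factor
\<open>(c z + d)\<^sup>-\<^sup>2\<close> because \<open>g\<close> has determinant one, and differentiating \<open>(c z + d)\<^sup>-\<^sup>k\<close> brings \<open>- k c\<close>
and lowers the exponent by one.\<close>

lemma DERIV_varpi:
  assumes g: "g \<in> SL2" "denom g z \<noteq> 0"
    and f: "(f has_field_derivative f' (moebius_transf (matrix_inv g) z)) (at (moebius_transf (matrix_inv g) z))"
  shows "(varpi k g f has_field_derivative
    varpi (k + 2) g f' z - of_nat k * matrix_inv g $ 2 $ 1 * varpi (k + 1) g f z) (at z)"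
proof -
  have D1: "((\<lambda>z. f (moebius_transf (matrix_inv g) z)) has_field_derivative
      f' (moebius_transf (matrix_inv g) z) * inverse (denom g z) ^ 2) (at z)"
    by (rule DERIV_chain2[OF f DERIV_moebius[OF g]])
  have "((\<lambda>z. inverse (denom g z)) has_field_derivative
      - matrix_inv g $ 2 $ 1 * inverse (denom g z) ^ 2) (at z)"
    using g(2) unfolding denom_def by (auto intro!: derivative_eq_intros simp: power2_eq_square)
  from DERIV_power[OF this, of k]
  have D2: "((\<lambda>z. inverse (denom g z) ^ k) has_field_derivative
      - of_nat k * matrix_inv g $ 2 $ 1 * inverse (denom g z) ^ (k + 1)) (at z)"
    by (rule DERIV_cong) (cases k; simp add: power2_eq_square algebra_simps)
  have "((\<lambda>z. inverse (denom g z) ^ k * f (moebius_transf (matrix_inv g) z)) has_field_derivative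
      varpi (k + 2) g f' z - of_nat k * matrix_inv g $ 2 $ 1 * varpi (k + 1) g f z) (at z)"
    by (rule DERIV_cong[OF DERIV_mult[OF D2 D1]]) (simp add: varpi_eq power_add power2_eq_square algebra_simps)
  then show ?thesis by (simp add: varpi_eq[abs_def])
qed

definition inverse_preserves :: "complex^2^2 \<Rightarrow> complex set \<Rightarrow> bool" where
  "inverse_preserves g D \<longleftrightarrow> (\<forall>z\<in>D. denom g z \<noteq> 0 \<and> moebius_transf (matrix_inv g) z \<in> D)"

lemma inverse_preserves_if_subset:
  assumes "g \<in> SL2" "Some ` D \<subseteq> moebius_sphere g ` Some ` D"
  shows "inverse_preserves g D"
  using assms(2) unfolding subset_moebius_sphere_iff[OF assms(1)] by (simp add: inverse_preserves_def denom_def)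

lemma holomorphic_moebius:
  assumes "g \<in> SL2" "inverse_preserves g D"
  shows "moebius_transf (matrix_inv g) holomorphic_on D"
  unfolding holomorphic_on_def field_differentiable_def
proof (intro ballI exI)
  fix z assume "z \<in> D"
  then have "denom g z \<noteq> 0" using assms(2) by (simp add: inverse_preserves_def)
  from has_field_derivative_at_within[OF DERIV_moebius[OF assms(1) this]]
  show "(moebius_transf (matrix_inv g) has_field_derivative inverse (denom g z) ^ 2) (at z within D)" .
qed

lemma holomorphic_inverse_denom:
  assumes "inverse_preserves g D"
  shows "(\<lambda>z. inverse (denom g z)) holomorphic_on D"
  using assms unfolding denom_def inverse_preserves_def by (intro holomorphic_intros) auto

lemma holomorphic_varpi:
  assumes "g \<in> SL2" "inverse_preserves g D" "f holomorphic_on D"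
  shows "varpi k g f holomorphic_on D"
proof -
  have "(\<lambda>z. f (moebius_transf (matrix_inv g) z)) holomorphic_on D"
    using holomorphic_on_compose_gen[OF holomorphic_moebius[OF assms(1,2)] assms(3)] assms(2)
    by (auto simp: inverse_preserves_def o_def)
  then show ?thesis
    unfolding varpi_eq[abs_def] by (intro holomorphic_on_mult holomorphic_on_power holomorphic_inverse_denom[OF assms(2)])
qed

text \<open>The solution with \<open>T 0 0 = 1\<close> of the recurrence \<open>T (n + 1) m = (k + n + m) T n m + T n (m - 1)\<close>, the last
term being absent for \<open>m = 0\<close>, to which iterating \<open>DERIV_varpi\<close> leads.\<close>

definition varpi_coeff :: "nat \<Rightarrow> nat \<Rightarrow> nat \<Rightarrow> complex" where
  "varpi_coeff k n m = of_nat (n choose m) * fact (k + n - 1) / fact (k + m - 1)"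

lemma varpi_coeff_eq_0: "n < m \<Longrightarrow> varpi_coeff k n m = 0"
  by (simp add: varpi_coeff_def)

lemma varpi_coeff_Suc_0:
  assumes "k \<ge> 1"
  shows "varpi_coeff k (Suc n) 0 = of_nat (k + n) * varpi_coeff k n 0"
proof -
  obtain k' where "k = Suc k'" using assms by (cases k) auto
  then show ?thesis by (simp add: varpi_coeff_def)
qed

lemma varpi_coeff_Suc_Suc:
  assumes "k \<ge> 1"
  shows "varpi_coeff k (Suc n) (Suc m) = of_nat (k + n + Suc m) * varpi_coeff k n (Suc m) + varpi_coeff k n m"
proof -
  obtain k' where k: "k = Suc k'" using assms by (cases k) auto
  have "Suc m * (n choose Suc m) + m * (n choose m) = n * (n choose m)"
  proof (cases "m \<le> n")
    case True
    then have "Suc m * (n choose Suc m) = (n - m) * (n choose m)"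
      using binomial_absorption[of m n] binomial_absorb_comp[of n m] by simp
    then show ?thesis using True by (simp flip: add_mult_distrib)
  qed (simp add: binomial_eq_0)
  then have "of_nat (Suc m) * of_nat (n choose Suc m) + of_nat m * of_nat (n choose m)
      = (of_nat n * of_nat (n choose m) :: complex)"
    by (metis of_nat_add of_nat_mult)
  then have *: "of_nat (Suc n choose Suc m) * of_nat (Suc k' + n)
      = of_nat (Suc k' + n + Suc m) * of_nat (n choose Suc m) + (of_nat (n choose m) * of_nat (Suc k' + m) :: complex)"
    by (simp add: algebra_simps)
  have "varpi_coeff k (Suc n) (Suc m) = of_nat (Suc n choose Suc m) * of_nat (Suc k' + n) * fact (k' + n) / fact (Suc k' + m)"
    by (simp add: varpi_coeff_def k)
  also have "\<dots> = of_nat (k + n + Suc m) * varpi_coeff k n (Suc m) + varpi_coeff k n m"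
    using of_nat_neq_0[of "k' + m", where ?'a = complex]
    unfolding * by (simp add: varpi_coeff_def k divide_simps add.assoc) (simp add: algebra_simps)
  finally show ?thesis .
qed

text \<open>The two terms of \<open>DERIV_varpi\<close> raise \<open>m\<close> by one or keep it; in either case the weight
\<open>k + n + m\<close> is again the right one for \<open>n + 1\<close>. Collecting the terms with equal \<open>m\<close> is the
recurrence for the coefficients.\<close>

lemma higher_deriv_varpi:
  assumes "open D" "g \<in> SL2" "inverse_preserves g D" "f holomorphic_on D" "k \<ge> 1" "z \<in> D"
  shows "(deriv ^^ n) (varpi k g f) z = (\<Sum>m\<le>n. varpi_coeff k n m * (- matrix_inv g $ 2 $ 1) ^ (n - m)
    * varpi (k + n + m) g ((deriv ^^ m) f) z)"
  using \<open>z \<in> D\<close>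
proof (induction n arbitrary: z)
  case 0
  then show ?case by (simp add: varpi_coeff_def)
next
  case (Suc n)
  let ?c = "- matrix_inv g $ 2 $ 1"
  define V where "V n m = varpi (k + n + m) g ((deriv ^^ m) f) z" for n m
  have V: "((\<lambda>z. varpi (k + n + m) g ((deriv ^^ m) f) z) has_field_derivative
      V (Suc n) (Suc m) + of_nat (k + n + m) * ?c * V (Suc n) m) (at z)" for m
  proof -
    have "moebius_transf (matrix_inv g) z \<in> D" "denom g z \<noteq> 0"
      using assms(3) Suc.prems by (auto simp: inverse_preserves_def)
    then show ?thesis
      using DERIV_varpi[of g z "(deriv ^^ m) f" "(deriv ^^ Suc m) f" "k + n + m"] assms(2)
        has_field_derivative_higher_deriv[OF assms(4,1), of _ m]
      by (simp add: V_def)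
  qed
  have "(deriv ^^ Suc n) (varpi k g f) z = deriv (\<lambda>z. \<Sum>m\<le>n. varpi_coeff k n m * ?c ^ (n - m)
    * varpi (k + n + m) g ((deriv ^^ m) f) z) z"
    using higher_deriv_cong_open[OF \<open>open D\<close> Suc.prems Suc.IH, where n = 1] by simp
  also have "\<dots> = (\<Sum>m\<le>n. varpi_coeff k n m * ?c ^ (n - m)
      * (V (Suc n) (Suc m) + of_nat (k + n + m) * ?c * V (Suc n) m))"
    by (intro DERIV_imp_deriv DERIV_sum DERIV_cmult V)
  also have "\<dots> = (\<Sum>m\<le>n. varpi_coeff k n m * ?c ^ (n - m) * V (Suc n) (Suc m))
      + (\<Sum>m\<le>n. of_nat (k + n + m) * varpi_coeff k n m * ?c ^ (Suc n - m) * V (Suc n) m)"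
    unfolding sum.distrib[symmetric] by (rule sum.cong[OF refl]) (simp add: Suc_diff_le algebra_simps)
  also have "(\<Sum>m\<le>n. of_nat (k + n + m) * varpi_coeff k n m * ?c ^ (Suc n - m) * V (Suc n) m)
      = (\<Sum>m\<le>Suc n. of_nat (k + n + m) * varpi_coeff k n m * ?c ^ (Suc n - m) * V (Suc n) m)"
    by (simp add: varpi_coeff_eq_0)
  also have "(\<Sum>m\<le>n. varpi_coeff k n m * ?c ^ (n - m) * V (Suc n) (Suc m)) + \<dots>
      = (\<Sum>m\<le>Suc n. varpi_coeff k (Suc n) m * ?c ^ (Suc n - m) * V (Suc n) m)"
    unfolding sum.atMost_Suc_shift
    using assms(5) by (simp add: varpi_coeff_Suc_0 varpi_coeff_Suc_Suc distrib_right sum.distrib)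
  finally show ?case by (simp add: V_def)
qed

section \<open>Covariance under the group\<close>

lemma boxtimes_varpi_eq:
  "(varpi k1 g \<boxtimes> varpi k2 g) f = (\<lambda>(z1, z2). inverse (denom g z1) ^ k1 * inverse (denom g z2) ^ k2
    * f (moebius_transf (matrix_inv g) z1, moebius_transf (matrix_inv g) z2))"
  by (simp add: boxtimes_def varpi_eq mult.assoc)

lemma sep_hol_boxtimes_varpi:
  assumes "open D" "g \<in> SL2" "inverse_preserves g D" "f \<in> sep_hol D D"
  shows "(varpi k1 g \<boxtimes> varpi k2 g) f \<in> sep_hol D D"
proof -
  let ?M = "moebius_transf (matrix_inv g)"
  have M: "?M z \<in> D" if "z \<in> D" for z using assms(3) that by (simp add: inverse_preserves_def)
  have Mc: "continuous_on D ?M" and Jc: "continuous_on D (\<lambda>z. inverse (denom g z))"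
    using holomorphic_moebius[OF assms(2,3)] holomorphic_inverse_denom[OF assms(3)]
    by (simp_all add: holomorphic_on_imp_continuous_on)
  have fc: "continuous_on (D \<times> D) f" using assms(4) by (simp add: sep_hol_def)
  have "continuous_on (D \<times> D) ((varpi k1 g \<boxtimes> varpi k2 g) f)"
    unfolding boxtimes_varpi_eq split_beta
    by (intro continuous_intros continuous_on_compose2[OF fc] continuous_on_compose2[OF Mc]
        continuous_on_compose2[OF Jc]) (auto simp: M)
  moreover have "(\<lambda>z. (varpi k1 g \<boxtimes> varpi k2 g) f (z, w)) holomorphic_on D" if "w \<in> D" for w
  proof -
    have "(\<lambda>z. inverse (denom g w) ^ k2 * f (z, ?M w)) holomorphic_on D"
      using assms that M by (intro holomorphic_on_mult holomorphic_on_const sep_hol_holomorphic1[of _ D D])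
    from holomorphic_varpi[OF assms(2,3) this, of k1]
    show ?thesis by (simp add: boxtimes_def varpi_eq[abs_def])
  qed
  moreover have "(\<lambda>w. (varpi k1 g \<boxtimes> varpi k2 g) f (z, w)) holomorphic_on D" if "z \<in> D" for z
  proof -
    have "(\<lambda>w. inverse (denom g z) ^ k1 * varpi k2 g (\<lambda>w. f (?M z, w)) w) holomorphic_on D"
      using assms that M by (intro holomorphic_on_mult holomorphic_on_const holomorphic_varpi sep_hol_holomorphic2)
    then show ?thesis by (simp add: boxtimes_def varpi_eq[abs_def])
  qed
  ultimately show ?thesis by (simp add: sep_hol_def)
qed

text \<open>The formula for one variable, used once in each. After the second variable has been treated, what
is left is again of the form \<open>varpi k1 g F\<close> in the first, with \<open>F\<close> a linear combination of
derivatives of \<open>f\<close> in the second variable.\<close>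

lemma pderiv2_boxtimes_varpi:
  assumes "open D" "g \<in> SL2" "inverse_preserves g D" "f \<in> sep_hol D D" "k1 \<ge> 1" "k2 \<ge> 1" "z1 \<in> D" "z2 \<in> D"
  defines "c \<equiv> - matrix_inv g $ 2 $ 1" and "M \<equiv> moebius_transf (matrix_inv g)"
  shows "pderiv2 i j ((varpi k1 g \<boxtimes> varpi k2 g) f) (z1, z2)
    = (\<Sum>a\<le>i. \<Sum>b\<le>j. varpi_coeff k1 i a * varpi_coeff k2 j b * c ^ (i - a) * c ^ (j - b)
        * inverse (denom g z1) ^ (k1 + i + a) * inverse (denom g z2) ^ (k2 + j + b)
        * pderiv2 a b f (M z1, M z2))"
proof -
  have M: "M z \<in> D" if "z \<in> D" for z using assms(3) that by (simp add: inverse_preserves_def M_def)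
  define C where "C b = varpi_coeff k2 j b * c ^ (j - b) * inverse (denom g z2) ^ (k2 + j + b)" for b
  have "(partial2 ^^ j) ((varpi k1 g \<boxtimes> varpi k2 g) f) (u, z2)
      = varpi k1 g (\<lambda>v. \<Sum>b\<le>j. C b * (partial2 ^^ b) f (v, M z2)) u" if u: "u \<in> D" for u
  proof -
    have "(partial2 ^^ j) ((varpi k1 g \<boxtimes> varpi k2 g) f) (u, z2)
        = (deriv ^^ j) (\<lambda>w. inverse (denom g u) ^ k1 * varpi k2 g (\<lambda>w. f (M u, w)) w) z2"
      by (simp add: funpow_partial2 boxtimes_def varpi_eq M_def)
    also have "\<dots> = inverse (denom g u) ^ k1 * (deriv ^^ j) (varpi k2 g (\<lambda>w. f (M u, w))) z2"
      using assms M[OF u] by (intro higher_deriv_cmult[of _ D] holomorphic_varpi sep_hol_holomorphic2)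
    also have "(deriv ^^ j) (varpi k2 g (\<lambda>w. f (M u, w))) z2
        = (\<Sum>b\<le>j. C b * (partial2 ^^ b) f (M u, M z2))"
      using higher_deriv_varpi[OF assms(1-3) sep_hol_holomorphic2[OF assms(4) M[OF u]] assms(6,8), of j]
      by (simp add: C_def c_def M_def varpi_eq funpow_partial2 mult_ac)
    finally show ?thesis unfolding varpi_eq[of _ _ _ u] M_def .
  qed
  then have "pderiv2 i j ((varpi k1 g \<boxtimes> varpi k2 g) f) (z1, z2)
      = (deriv ^^ i) (varpi k1 g (\<lambda>v. \<Sum>b\<le>j. C b * (partial2 ^^ b) f (v, M z2))) z1"
    unfolding pderiv2_apply by (intro higher_deriv_cong_open[OF assms(1,7)])
  also have "\<dots> = (\<Sum>a\<le>i. varpi_coeff k1 i a * c ^ (i - a) * varpi (k1 + i + a) g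
      ((deriv ^^ a) (\<lambda>v. \<Sum>b\<le>j. C b * (partial2 ^^ b) f (v, M z2))) z1)"
    unfolding c_def using assms M
    by (intro higher_deriv_varpi[of D] holomorphic_intros sep_hol_holomorphic1[of _ D D] sep_hol_funpow_partial2) auto
  also have "\<dots> = (\<Sum>a\<le>i. varpi_coeff k1 i a * c ^ (i - a) * inverse (denom g z1) ^ (k1 + i + a)
      * (\<Sum>b\<le>j. C b * pderiv2 a b f (M z1, M z2)))"
  proof (intro sum.cong refl)
    fix a
    have "(deriv ^^ a) (\<lambda>v. \<Sum>b\<le>j. C b * (partial2 ^^ b) f (v, M z2)) (M z1)
        = (\<Sum>b\<le>j. C b * pderiv2 a b f (M z1, M z2))"
      unfolding pderiv2_apply using assms M
      by (intro higher_deriv_linear_combination[of D] sep_hol_holomorphic1[of _ D D] sep_hol_funpow_partial2) auto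
    then show "varpi_coeff k1 i a * c ^ (i - a) * varpi (k1 + i + a) g
        ((deriv ^^ a) (\<lambda>v. \<Sum>b\<le>j. C b * (partial2 ^^ b) f (v, M z2))) z1
      = varpi_coeff k1 i a * c ^ (i - a) * inverse (denom g z1) ^ (k1 + i + a)
        * (\<Sum>b\<le>j. C b * pderiv2 a b f (M z1, M z2))"
      by (simp add: varpi_eq M_def)
  qed
  also have "\<dots> = (\<Sum>a\<le>i. \<Sum>b\<le>j. varpi_coeff k1 i a * varpi_coeff k2 j b * c ^ (i - a) * c ^ (j - b)
        * inverse (denom g z1) ^ (k1 + i + a) * inverse (denom g z2) ^ (k2 + j + b)
        * pderiv2 a b f (M z1, M z2))"
    by (simp add: C_def sum_distrib_left mult_ac)
  finally show ?thesis .
qed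

text \<open>The binomial expansion of \<open>(1 - 1)\<^sup>n\<close>, divided by \<open>n!\<close>.\<close>

lemma alternating_sum_inverse_fact:
  "(\<Sum>i\<le>n. (- 1) ^ i / (fact i * fact (n - i))) = (if n = 0 then 1 else 0 :: complex)"
proof -
  have "(\<Sum>i\<le>n. (- 1) ^ i / (fact i * fact (n - i))) = (\<Sum>i\<le>n. (- 1) ^ i * of_nat (n choose i)) / (fact n :: complex)"
    unfolding sum_divide_distrib by (intro sum.cong refl) (simp add: binomial_fact)
  then show ?thesis by (simp add: choose_alternating_sum)
qed

text \<open>The factorials \<open>(k1 + l - j - 1)!\<close> and \<open>(k2 + j - 1)!\<close> from differentiating cancel against the
denominators of the binomial coefficients of the bracket, and \<open>j!\<close> and \<open>(l - j)!\<close> cancel too. This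
is why the bracket has the coefficients it has: only an alternating sum of inverse factorials in
\<open>j\<close> remains.\<close>

lemma rc_coeff_varpi_coeff:
  assumes "k1 \<ge> 1" "k2 \<ge> 1" "b \<le> j" "a + j \<le> l"
  shows "rc_coeff k1 k2 l j * varpi_coeff k1 (l - j) a * varpi_coeff k2 j b
    = fact (k1 + l - 1) * fact (k2 + l - 1) / (fact (k1 + a - 1) * fact (k2 + b - 1) * fact a * fact b)
      * ((- 1) ^ j / (fact (j - b) * fact (l - j - a)))"
proof -
  have le: "j \<le> k1 + l - 1" "l - j \<le> k2 + l - 1" "a \<le> l - j" 
    and eq: "k1 + l - 1 - j = k1 + (l - j) - 1" "k2 + l - 1 - (l - j) = k2 + j - 1"
    using assms by auto
  show ?thesis
    unfolding rc_coeff_def varpi_coeff_def binomial_fact[OF le(1)] binomial_fact[OF le(2)]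
      binomial_fact[OF le(3)] binomial_fact[OF assms(3)] eq
    by (simp add: field_simps)
qed

text \<open>Only the terms with \<open>b \<le> j \<le> l - a\<close> are nonzero. Substituting \<open>j = i + b\<close> turns them into the
alternating sum above for \<open>n = l - a - b\<close>, which survives only for \<open>n = 0\<close>, that is, for the single
term \<open>j = b\<close>.\<close>

lemma sum_rc_coeff_varpi_coeff:
  assumes "k1 \<ge> 1" "k2 \<ge> 1"
  shows "(\<Sum>j\<le>l. rc_coeff k1 k2 l j * varpi_coeff k1 (l - j) a * varpi_coeff k2 j b)
    = (if a + b = l then rc_coeff k1 k2 l b else 0)"
proof (cases "a + b \<le> l")
  case False
  have "a > l - j \<or> b > j" if "j \<le> l" for j using that False by linarith
  then have "rc_coeff k1 k2 l j * varpi_coeff k1 (l - j) a * varpi_coeff k2 j b = 0" if "j \<le> l" for j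
    using that varpi_coeff_eq_0 mult_zero_left mult_zero_right by metis
  then have "(\<Sum>j\<le>l. rc_coeff k1 k2 l j * varpi_coeff k1 (l - j) a * varpi_coeff k2 j b) = 0"
    by (intro sum.neutral) auto
  then show ?thesis
    using False by simp
next
  case True
  define n where "n = l - (a + b)"
  have l: "l = a + b + n" using True by (simp add: n_def)
  define K :: complex where "K = fact (k1 + l - 1) * fact (k2 + l - 1)
    / (fact (k1 + a - 1) * fact (k2 + b - 1) * fact a * fact b)"
  have K: "K * (- 1) ^ b = rc_coeff k1 k2 l b" if "n = 0"
  proof -
    have le: "b \<le> k1 + l - 1" "a \<le> k2 + l - 1" "l - b = a"
      and eq: "k1 + l - 1 - b = k1 + a - 1" "k2 + l - 1 - a = k2 + b - 1"
      using assms that by (auto simp: l)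
    show ?thesis
      unfolding rc_coeff_def K_def le(3) binomial_fact[OF le(1)] binomial_fact[OF le(2)] eq by (simp add: mult_ac)
  qed
  have "(\<Sum>j\<le>l. rc_coeff k1 k2 l j * varpi_coeff k1 (l - j) a * varpi_coeff k2 j b)
      = (\<Sum>j=b..b+n. rc_coeff k1 k2 l j * varpi_coeff k1 (l - j) a * varpi_coeff k2 j b)"
  proof (intro sum.mono_neutral_right ballI)
    fix j assume "j \<in> {..l} - {b..b+n}"
    then have "j < b \<or> l - j < a" by (auto simp: l)
    then show "rc_coeff k1 k2 l j * varpi_coeff k1 (l - j) a * varpi_coeff k2 j b = 0"
      by (auto simp: varpi_coeff_eq_0)
  qed (auto simp: l)
  also have "\<dots> = (\<Sum>j=b..b+n. K * ((- 1) ^ j / (fact (j - b) * fact (l - j - a))))"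
    unfolding K_def using assms by (intro sum.cong refl rc_coeff_varpi_coeff) (auto simp: l)
  also have "\<dots> = (\<Sum>i\<le>n. K * ((- 1) ^ (i + b) / (fact i * fact (n - i))))"
    by (rule sum.reindex_bij_witness[of _ "\<lambda>i. i + b" "\<lambda>j. j - b"]) (auto simp: l add.commute)
  also have "\<dots> = K * (- 1) ^ b * (\<Sum>i\<le>n. (- 1) ^ i / (fact i * fact (n - i)))"
    by (simp add: sum_distrib_left power_add mult_ac)
  also have "\<dots> = (if n = 0 then K * (- 1) ^ b else 0)"
    unfolding alternating_sum_inverse_fact by simp
  also have "\<dots> = (if a + b = l then rc_coeff k1 k2 l b else 0)"
    using K by (simp add: l)
  finally show ?thesis .
qed

text \<open>Every mixed derivative of \<open>f\<close> of order \<open>a + b \<le> l\<close> at the image point occurs, with a factor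
depending only on \<open>a\<close> and \<open>b\<close> times the sum evaluated in \<open>sum_rc_coeff_varpi_coeff\<close>. The orders
below \<open>l\<close> therefore cancel, and those of order \<open>l\<close> form the bracket with the automorphy factor in
front.\<close>

lemma RC_varpi:
  assumes "open D" "g \<in> SL2" "inverse_preserves g D" "f \<in> sep_hol D D" "k1 \<ge> 1" "k2 \<ge> 1" "z \<in> D"
  shows "RC k1 k2 l ((varpi k1 g \<boxtimes> varpi k2 g) f) z = varpi (k1 + k2 + 2 * l) g (RC k1 k2 l f) z"
proof -
  let ?T1 = "varpi_coeff k1" and ?T2 = "varpi_coeff k2" and ?R = "rc_coeff k1 k2 l"
  define c where "c = - matrix_inv g $ 2 $ 1"
  define w where "w = moebius_transf (matrix_inv g) z"
  define J where "J = inverse (denom g z)"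
  define W where "W a b = c ^ (l - (a + b)) * J ^ (k1 + k2 + l + (a + b)) * pderiv2 a b f (w, w)" for a b
  have *: "pderiv2 (l - j) j ((varpi k1 g \<boxtimes> varpi k2 g) f) (z, z)
      = (\<Sum>a\<le>l. \<Sum>b\<le>l. ?T1 (l - j) a * ?T2 j b * W a b)" if j: "j \<le> l" for j
  proof -
    have "pderiv2 (l - j) j ((varpi k1 g \<boxtimes> varpi k2 g) f) (z, z)
        = (\<Sum>a\<le>l - j. \<Sum>b\<le>j. ?T1 (l - j) a * ?T2 j b * W a b)"
      unfolding pderiv2_boxtimes_varpi[OF assms(1-6,7,7)]
    proof (intro sum.cong refl)
      fix a b assume ab: "a \<in> {..l - j}" "b \<in> {..j}"
      have "c ^ (l - (a + b)) = c ^ (l - j - a) * c ^ (j - b)"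
        unfolding power_add[symmetric] using ab j by (intro arg_cong[of _ _ "\<lambda>n. c ^ n"]) auto
      moreover have "J ^ (k1 + k2 + l + (a + b)) = J ^ (k1 + (l - j) + a) * J ^ (k2 + j + b)"
        unfolding power_add[symmetric] using j by (intro arg_cong[of _ _ "\<lambda>n. J ^ n"]) auto
      ultimately show "?T1 (l - j) a * ?T2 j b * (- matrix_inv g $ 2 $ 1) ^ (l - j - a)
          * (- matrix_inv g $ 2 $ 1) ^ (j - b) * inverse (denom g z) ^ (k1 + (l - j) + a)
          * inverse (denom g z) ^ (k2 + j + b)
          * pderiv2 a b f (moebius_transf (matrix_inv g) z, moebius_transf (matrix_inv g) z)
        = ?T1 (l - j) a * ?T2 j b * W a b"
        unfolding W_def c_def[symmetric] w_def[symmetric] J_def[symmetric] by (simp only: mult_ac)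
    qed
    \<comment> \<open>the coefficients vanish beyond these ranges, and ranges free of \<open>j\<close> can be interchanged with
      the sum over \<open>j\<close>\<close>
    also have "\<dots> = (\<Sum>a\<le>l - j. \<Sum>b\<le>l. ?T1 (l - j) a * ?T2 j b * W a b)"
      using j by (intro sum.cong refl sum.mono_neutral_left) (auto simp: varpi_coeff_eq_0)
    also have "\<dots> = (\<Sum>a\<le>l. \<Sum>b\<le>l. ?T1 (l - j) a * ?T2 j b * W a b)"
      using j by (intro sum.mono_neutral_left) (auto simp: varpi_coeff_eq_0)
    finally show ?thesis .
  qed
  have "RC k1 k2 l ((varpi k1 g \<boxtimes> varpi k2 g) f) z
      = (\<Sum>j\<le>l. \<Sum>a\<le>l. \<Sum>b\<le>l. ?R j * ?T1 (l - j) a * ?T2 j b * W a b)"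
    unfolding RC_eq by (intro sum.cong refl) (simp add: * sum_distrib_left mult.assoc)
  also have "\<dots> = (\<Sum>a\<le>l. \<Sum>b\<le>l. \<Sum>j\<le>l. ?R j * ?T1 (l - j) a * ?T2 j b * W a b)"
    by (rule trans[OF sum.swap]) (intro sum.cong refl sum.swap)
  also have "\<dots> = (\<Sum>a\<le>l. \<Sum>b\<le>l. (if a + b = l then ?R b else 0) * W a b)"
    unfolding sum_distrib_right[symmetric] sum_rc_coeff_varpi_coeff[OF assms(5,6)] ..
  also have "\<dots> = (\<Sum>b\<le>l. \<Sum>a\<le>l. if a = l - b then ?R b * W a b else 0)"
    by (rule trans[OF sum.swap]) (intro sum.cong refl, auto)
  also have "\<dots> = (\<Sum>b\<le>l. ?R b * W (l - b) b)"
    by simp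
  also have "\<dots> = J ^ (k1 + k2 + 2 * l) * RC k1 k2 l f w"
    unfolding RC_eq sum_distrib_left
    by (intro sum.cong refl) (simp add: W_def mult_2 add.assoc)
  finally show ?thesis
    by (simp add: varpi_eq J_def w_def)
qed

section \<open>Infinitesimal covariance\<close>

lemma dvarpi_eq:
  "dvarpi k Z f z = - of_nat k * (Z$1$1 - Z$2$1 * z) * f z
    - (2 * Z$1$1 * z + Z$1$2 - Z$2$1 * z ^ 2) * deriv f z"
  by (simp add: dvarpi_def Let_def)

text \<open>Differentiating the coefficient \<open>2 p z + q - r z\<^sup>2\<close> of the vector field gives \<open>2 (p - r z)\<close>, which
raises the weight by two; the derivative of \<open>- k (p - r z)\<close> is the correction \<open>k r\<close>.\<close>

lemma DERIV_dvarpi: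
  assumes "open D" "f holomorphic_on D" "z \<in> D"
  shows "(dvarpi k Z f has_field_derivative dvarpi (k + 2) Z (deriv f) z + of_nat k * Z$2$1 * f z) (at z)"
proof -
  have "(f has_field_derivative deriv f z) (at z)"
    "(deriv f has_field_derivative deriv (deriv f) z) (at z)"
    using assms by (auto intro!: holomorphic_derivI holomorphic_deriv)
  then show ?thesis
    unfolding dvarpi_def[abs_def] Let_def
    by (auto intro!: derivative_eq_intros simp: algebra_simps power2_eq_square)
qed

text \<open>The corrections from the successive weights add up: \<open>k + (k + 2) + \<dots> + (k + 2 n - 2) = n (k + n - 1)\<close>.
For \<open>n = 0\<close> the last term vanishes, whatever \<open>n - 1\<close> means there.\<close>

lemma higher_deriv_dvarpi:
  assumes "open D" "f holomorphic_on D" "z \<in> D"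
  shows "(deriv ^^ n) (dvarpi k Z f) z = dvarpi (k + 2 * n) Z ((deriv ^^ n) f) z
    + of_nat (n * (k + n - 1)) * Z$2$1 * (deriv ^^ (n - 1)) f z"
  using assms(3)
proof (induction n arbitrary: z)
  case (Suc n)
  let ?r = "Z$2$1"
  have D: "((deriv ^^ m) f has_field_derivative (deriv ^^ Suc m) f z) (at z)" for m
    using has_field_derivative_higher_deriv[OF assms(2,1) Suc.prems] .
  have "((\<lambda>z. of_nat (n * (k + n - 1)) * ?r * (deriv ^^ (n - 1)) f z) has_field_derivative
      of_nat (n * (k + n - 1)) * ?r * (deriv ^^ n) f z) (at z)"
    using DERIV_cmult[OF D[of "n - 1"]] by (cases n) auto
  moreover have "(dvarpi (k + 2 * n) Z ((deriv ^^ n) f) has_field_derivative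
      dvarpi (k + 2 * Suc n) Z ((deriv ^^ Suc n) f) z + of_nat (k + 2 * n) * ?r * (deriv ^^ n) f z) (at z)"
    using DERIV_dvarpi[OF assms(1) holomorphic_higher_deriv[OF assms(2,1)] Suc.prems, of "k + 2 * n" Z n] by simp
  ultimately have "((\<lambda>z. dvarpi (k + 2 * n) Z ((deriv ^^ n) f) z + of_nat (n * (k + n - 1)) * ?r * (deriv ^^ (n - 1)) f z)
      has_field_derivative dvarpi (k + 2 * Suc n) Z ((deriv ^^ Suc n) f) z + of_nat (k + 2 * n) * ?r * (deriv ^^ n) f z
       + of_nat (n * (k + n - 1)) * ?r * (deriv ^^ n) f z) (at z)"
    by (rule DERIV_add[rotated])
  moreover have "of_nat (k + 2 * n) * ?r * (deriv ^^ n) f z + of_nat (n * (k + n - 1)) * ?r * (deriv ^^ n) f z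
     = of_nat (Suc n * (k + Suc n - 1)) * ?r * (deriv ^^ n) f z"
    by (cases n) (simp_all add: algebra_simps)
  ultimately have "deriv (\<lambda>z. dvarpi (k + 2 * n) Z ((deriv ^^ n) f) z + of_nat (n * (k + n - 1)) * ?r * (deriv ^^ (n - 1)) f z) z
      = dvarpi (k + 2 * Suc n) Z ((deriv ^^ Suc n) f) z + of_nat (Suc n * (k + Suc n - 1)) * ?r * (deriv ^^ n) f z"
    by (intro DERIV_imp_deriv) (simp only: add.assoc)
  then show ?case
    using higher_deriv_cong_open[OF \<open>open D\<close> Suc.prems Suc.IH, where n = 1] by simp
qed simp

lemma holomorphic_dvarpi:
  assumes "open D" "f holomorphic_on D"
  shows "dvarpi k Z f holomorphic_on D"
  unfolding holomorphic_on_open[OF assms(1)] using DERIV_dvarpi[OF assms] by blast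

lemma boxtimes_dvarpi1_eq:
  "(dvarpi k Z \<boxtimes> id) f = (\<lambda>p. - of_nat k * (Z$1$1 - Z$2$1 * fst p) * f p
    - (2 * Z$1$1 * fst p + Z$1$2 - Z$2$1 * fst p ^ 2) * partial1 f p)"
  by (simp add: fun_eq_iff boxtimes_dvarpi_id dvarpi_eq partial1_def)

lemma boxtimes_dvarpi2_eq:
  "(id \<boxtimes> dvarpi k Z) f = (\<lambda>p. - of_nat k * (Z$1$1 - Z$2$1 * snd p) * f p
    - (2 * Z$1$1 * snd p + Z$1$2 - Z$2$1 * snd p ^ 2) * partial2 f p)"
  by (simp add: fun_eq_iff boxtimes_dvarpi_id dvarpi_eq partial2_def)

lemma sep_hol_boxtimes_dvarpi1:
  assumes "open A" "open B" "f \<in> sep_hol A B"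
  shows "(dvarpi k Z \<boxtimes> id) f \<in> sep_hol A B"
  unfolding boxtimes_dvarpi1_eq
  by (intro sep_hol_diff sep_hol_mult assms sep_hol_partial1 sep_hol_fst[where h = "\<lambda>z. - of_nat k * (Z$1$1 - Z$2$1 * z)"]
      sep_hol_fst[where h = "\<lambda>z. 2 * Z$1$1 * z + Z$1$2 - Z$2$1 * z ^ 2"] holomorphic_intros)

lemma sep_hol_boxtimes_dvarpi2:
  assumes "open A" "open B" "f \<in> sep_hol A B"
  shows "(id \<boxtimes> dvarpi k Z) f \<in> sep_hol A B"
  unfolding boxtimes_dvarpi2_eq
  by (intro sep_hol_diff sep_hol_mult assms sep_hol_partial2 sep_hol_snd[where h = "\<lambda>z. - of_nat k * (Z$1$1 - Z$2$1 * z)"]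
      sep_hol_snd[where h = "\<lambda>z. 2 * Z$1$1 * z + Z$1$2 - Z$2$1 * z ^ 2"] holomorphic_intros)

text \<open>The operator in the first variable commutes with derivatives in the second, so only the derivatives
in the first variable contribute corrections.\<close>

lemma pderiv2_boxtimes_dvarpi1:
  assumes "open A" "open B" "f \<in> sep_hol A B" "z \<in> A" "w \<in> B"
  shows "pderiv2 i j ((dvarpi k Z \<boxtimes> id) f) (z, w)
    = - of_nat (k + 2 * i) * (Z$1$1 - Z$2$1 * z) * pderiv2 i j f (z, w)
      - (2 * Z$1$1 * z + Z$1$2 - Z$2$1 * z ^ 2) * pderiv2 (Suc i) j f (z, w)
      + of_nat (i * (k + i - 1)) * Z$2$1 * pderiv2 (i - 1) j f (z, w)"
proof -
  have "(partial2 ^^ j) ((dvarpi k Z \<boxtimes> id) f) (u, w) = dvarpi k Z (\<lambda>u. (partial2 ^^ j) f (u, w)) u"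
    if u: "u \<in> A" for u
  proof -
    let ?a = "- of_nat k * (Z$1$1 - Z$2$1 * u)" and ?b = "- (2 * Z$1$1 * u + Z$1$2 - Z$2$1 * u ^ 2)"
    have "(partial2 ^^ j) ((dvarpi k Z \<boxtimes> id) f) (u, w)
        = (deriv ^^ j) (\<lambda>v. ?a * f (u, v) + ?b * partial1 f (u, v)) w"
      unfolding funpow_partial2 boxtimes_dvarpi1_eq fst_conv diff_conv_add_uminus mult_minus_left ..
    also have "\<dots> = ?a * (deriv ^^ j) (\<lambda>v. f (u, v)) w + ?b * (deriv ^^ j) (\<lambda>v. partial1 f (u, v)) w"
      using assms u sep_hol_holomorphic2[OF sep_hol_partial1[OF assms(1-3)] u]
      by (subst higher_deriv_cmult_add[of B])
        (auto intro!: higher_deriv_cmult[of _ B] holomorphic_on_mult simp: sep_hol_holomorphic2)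
    also have "(deriv ^^ j) (\<lambda>v. partial1 f (u, v)) w = partial1 ((partial2 ^^ j) f) (u, w)"
      using funpow_partial2_partial1[OF assms(1-3) u assms(5), of j] by (simp add: funpow_partial2)
    finally show ?thesis
      unfolding dvarpi_eq[of _ _ _ u] partial1_def prod.case funpow_partial2 mult_minus_left
        diff_conv_add_uminus .
  qed
  then have "pderiv2 i j ((dvarpi k Z \<boxtimes> id) f) (z, w)
      = (deriv ^^ i) (dvarpi k Z (\<lambda>u. (partial2 ^^ j) f (u, w))) z"
    unfolding pderiv2_apply by (intro higher_deriv_cong_open[OF assms(1,4)])
  also have "\<dots> = dvarpi (k + 2 * i) Z ((deriv ^^ i) (\<lambda>u. (partial2 ^^ j) f (u, w))) z
    + of_nat (i * (k + i - 1)) * Z$2$1 * (deriv ^^ (i - 1)) (\<lambda>u. (partial2 ^^ j) f (u, w)) z"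
    using assms by (intro higher_deriv_dvarpi[of A] sep_hol_holomorphic1[of _ A B] sep_hol_funpow_partial2)
  finally show ?thesis
    unfolding dvarpi_eq[of _ _ _ z] pderiv2_apply by simp
qed

lemma pderiv2_boxtimes_dvarpi2:
  assumes "open A" "open B" "f \<in> sep_hol A B" "z \<in> A" "w \<in> B"
  shows "pderiv2 i j ((id \<boxtimes> dvarpi k Z) f) (z, w)
    = - of_nat (k + 2 * j) * (Z$1$1 - Z$2$1 * w) * pderiv2 i j f (z, w)
      - (2 * Z$1$1 * w + Z$1$2 - Z$2$1 * w ^ 2) * pderiv2 i (Suc j) f (z, w)
      + of_nat (j * (k + j - 1)) * Z$2$1 * pderiv2 i (j - 1) f (z, w)"
proof -
  let ?a = "- of_nat (k + 2 * j) * (Z$1$1 - Z$2$1 * w)" and ?b = "- (2 * Z$1$1 * w + Z$1$2 - Z$2$1 * w ^ 2)"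
    and ?c = "of_nat (j * (k + j - 1)) * Z$2$1"
  have hol: "(\<lambda>u. (partial2 ^^ m) f (u, w)) holomorphic_on A" for m
    using assms by (intro sep_hol_holomorphic1[of _ A B] sep_hol_funpow_partial2)
  have "(partial2 ^^ j) ((id \<boxtimes> dvarpi k Z) f) (u, w)
      = ?a * (partial2 ^^ j) f (u, w) + (?b * (partial2 ^^ Suc j) f (u, w) + ?c * (partial2 ^^ (j - 1)) f (u, w))"
    if u: "u \<in> A" for u
  proof -
    have "(partial2 ^^ j) ((id \<boxtimes> dvarpi k Z) f) (u, w) = (deriv ^^ j) (dvarpi k Z (\<lambda>v. f (u, v))) w"
      by (simp add: funpow_partial2 boxtimes_dvarpi_id)
    also have "\<dots> = dvarpi (k + 2 * j) Z ((deriv ^^ j) (\<lambda>v. f (u, v))) w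
        + ?c * (deriv ^^ (j - 1)) (\<lambda>v. f (u, v)) w"
      using assms u by (intro higher_deriv_dvarpi[of B] sep_hol_holomorphic2[of _ A B])
    finally show ?thesis
      unfolding dvarpi_eq[of _ _ _ w] funpow_partial2 by (simp del: minus_diff_eq)
  qed
  then have "pderiv2 i j ((id \<boxtimes> dvarpi k Z) f) (z, w)
      = (deriv ^^ i) (\<lambda>u. ?a * (partial2 ^^ j) f (u, w)
          + (?b * (partial2 ^^ Suc j) f (u, w) + ?c * (partial2 ^^ (j - 1)) f (u, w))) z"
    unfolding pderiv2_apply by (intro higher_deriv_cong_open[OF assms(1,4)])
  also have "\<dots> = ?a * pderiv2 i j f (z, w) + (?b * pderiv2 i (Suc j) f (z, w) + ?c * pderiv2 i (j - 1) f (z, w))"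
    unfolding pderiv2_apply using assms(1,4) hol
    by (simp only: higher_deriv_cmult_add[of A] higher_deriv_cmult[of _ A]
        holomorphic_on_mult holomorphic_on_add holomorphic_on_const)
  finally show ?thesis by (simp del: minus_diff_eq)
qed

lemma Suc_times_binomial_Suc: "Suc k * (n choose Suc k) = (n - k) * (n choose k)"
  using binomial_absorption[of k n] binomial_absorb_comp[of n k] by simp

text \<open>The mixed derivative of orders \<open>l - j - 1\<close> and \<open>j\<close> arises twice in the bracket of the transformed
function: as a correction in the first variable from the term \<open>j\<close> and as a correction in the second
from the term \<open>j + 1\<close>. The two contributions cancel.\<close>

lemma rc_coeff_telescope:
  assumes "j < l" "k1 \<ge> 1" "k2 \<ge> 1"
  shows "rc_coeff k1 k2 l j * of_nat ((l - j) * (k1 + (l - j) - 1))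
    + rc_coeff k1 k2 l (Suc j) * of_nat (Suc j * (k2 + Suc j - 1)) = 0"
proof -
  obtain m where l: "l = Suc (j + m)" using assms(1) less_iff_Suc_add by blast
  have A: "of_nat (Suc j) * of_nat ((k1 + l - 1) choose Suc j)
      = (of_nat (k1 + m) * of_nat ((k1 + l - 1) choose j) :: complex)"
    using arg_cong[OF Suc_times_binomial_Suc[of j "k1 + l - 1"], of "of_nat :: nat \<Rightarrow> complex"]
    unfolding of_nat_mult by (simp add: l add.commute)
  have B: "of_nat (Suc m) * of_nat ((k2 + l - 1) choose Suc m)
      = (of_nat (k2 + j) * of_nat ((k2 + l - 1) choose m) :: complex)"
    using arg_cong[OF Suc_times_binomial_Suc[of m "k2 + l - 1"], of "of_nat :: nat \<Rightarrow> complex"]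
    unfolding of_nat_mult by (simp add: l add.commute)
  have lj: "l - j = Suc m" "l - Suc j = m" "k1 + Suc m - 1 = k1 + m" "k2 + Suc j - 1 = k2 + j"
    by (simp_all add: l)
  have "rc_coeff k1 k2 l j * of_nat ((l - j) * (k1 + (l - j) - 1))
      = (-1) ^ j * (of_nat (k1 + m) * of_nat ((k1 + l - 1) choose j))
        * (of_nat (Suc m) * of_nat ((k2 + l - 1) choose Suc m))"
    unfolding rc_coeff_def lj of_nat_mult by (simp only: mult_ac)
  moreover have "rc_coeff k1 k2 l (Suc j) * of_nat (Suc j * (k2 + Suc j - 1))
      = - ((-1) ^ j * (of_nat (Suc j) * of_nat ((k1 + l - 1) choose Suc j))
        * (of_nat (k2 + j) * of_nat ((k2 + l - 1) choose m)))"
    unfolding rc_coeff_def lj of_nat_mult power_Suc by (simp only: mult_ac mult_1_left mult_minus_left mult_minus_right)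
  ultimately show ?thesis unfolding A B by simp
qed

text \<open>In the term \<open>j\<close> of the bracket the shifted weights \<open>k1 + 2 (l - j)\<close> and \<open>k2 + 2 j\<close> add up to
\<open>k1 + k2 + 2 l\<close> for every \<open>j\<close>; the first-order parts add up to the derivative of the bracket along
the diagonal; and the corrections cancel in pairs.\<close>

lemma RC_dvarpi:
  assumes "open D" "f \<in> sep_hol D D" "k1 \<ge> 1" "k2 \<ge> 1" "z \<in> D"
  shows "RC k1 k2 l (\<lambda>p. (dvarpi k1 Z \<boxtimes> id) f p + (id \<boxtimes> dvarpi k2 Z) f p) z
    = dvarpi (k1 + k2 + 2 * l) Z (RC k1 k2 l f) z"
proof -
  let ?R = "rc_coeff k1 k2 l"
  define P where "P = Z$1$1 - Z$2$1 * z"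
  define Q where "Q = 2 * Z$1$1 * z + Z$1$2 - Z$2$1 * z ^ 2"
  define r where "r = Z$2$1"
  define E where "E i j = pderiv2 i j f (z, z)" for i j
  define K :: complex where "K = of_nat (k1 + k2 + 2 * l)"
  \<comment> \<open>the corrections of order \<open>l - 1\<close> coming from the first and from the second variable\<close>
  define X where "X j = ?R j * of_nat ((l - j) * (k1 + (l - j) - 1)) * E (l - j - 1) j" for j
  define Y where "Y j = ?R j * of_nat (j * (k2 + j - 1)) * E (l - j) (j - 1)" for j
  have "?R j * pderiv2 (l - j) j (\<lambda>p. (dvarpi k1 Z \<boxtimes> id) f p + (id \<boxtimes> dvarpi k2 Z) f p) (z, z)
      = - K * P * (?R j * E (l - j) j) - Q * (?R j * (E (Suc (l - j)) j + E (l - j) (Suc j))) + r * (X j + Y j)"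
    if j: "j \<le> l" for j
  proof -
    have K: "K = of_nat (k1 + 2 * (l - j)) + of_nat (k2 + 2 * j)"
      unfolding K_def of_nat_add[symmetric] using j by (intro arg_cong[of _ _ of_nat]) simp
    have "pderiv2 (l - j) j (\<lambda>p. (dvarpi k1 Z \<boxtimes> id) f p + (id \<boxtimes> dvarpi k2 Z) f p) (z, z)
      = (- of_nat (k1 + 2 * (l - j)) * P * E (l - j) j - Q * E (Suc (l - j)) j
          + of_nat ((l - j) * (k1 + (l - j) - 1)) * r * E (l - j - 1) j)
        + (- of_nat (k2 + 2 * j) * P * E (l - j) j - Q * E (l - j) (Suc j)
          + of_nat (j * (k2 + j - 1)) * r * E (l - j) (j - 1))"
      using pderiv2_add[OF assms(1,1) sep_hol_boxtimes_dvarpi1[OF assms(1,1,2)]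
          sep_hol_boxtimes_dvarpi2[OF assms(1,1,2)] assms(5,5)]
        pderiv2_boxtimes_dvarpi1[OF assms(1,1,2,5,5)] pderiv2_boxtimes_dvarpi2[OF assms(1,1,2,5,5)]
      unfolding E_def P_def Q_def r_def by presburger
    then show ?thesis
      unfolding K X_def Y_def by (simp only: ring_distribs diff_conv_add_uminus mult_minus_left mult_minus_right minus_add_distrib mult_ac add_ac)
  qed
  then have "RC k1 k2 l (\<lambda>p. (dvarpi k1 Z \<boxtimes> id) f p + (id \<boxtimes> dvarpi k2 Z) f p) z
      = - K * P * (\<Sum>j\<le>l. ?R j * E (l - j) j) - Q * (\<Sum>j\<le>l. ?R j * (E (Suc (l - j)) j + E (l - j) (Suc j)))
        + r * (\<Sum>j\<le>l. X j + Y j)"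
    unfolding RC_eq sum_distrib_left sum_subtractf[symmetric] sum.distrib[symmetric]
    by (intro sum.cong refl) auto
  also have "(\<Sum>j\<le>l. X j + Y j) = 0"
  proof (cases l)
    case 0
    then show ?thesis by (simp add: X_def Y_def)
  next
    case (Suc m)
    have "(\<Sum>j\<le>l. X j + Y j) = (\<Sum>j\<le>l. X j) + (\<Sum>j\<le>l. Y j)"
      by (rule sum.distrib)
    also have "(\<Sum>j\<le>l. X j) = (\<Sum>j\<le>m. X j)"
      by (simp add: Suc X_def)
    also have "(\<Sum>j\<le>l. Y j) = (\<Sum>j\<le>m. Y (Suc j))"
      unfolding Suc sum.atMost_Suc_shift by (simp add: Y_def)
    also have "(\<Sum>j\<le>m. X j) + (\<Sum>j\<le>m. Y (Suc j)) = 0"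
      unfolding sum.distrib[symmetric]
    proof (intro sum.neutral ballI)
      fix j assume "j \<in> {..m}"
      then have "j < l" by (simp add: Suc)
      have "X j + Y (Suc j) = (?R j * of_nat ((l - j) * (k1 + (l - j) - 1))
          + ?R (Suc j) * of_nat (Suc j * (k2 + Suc j - 1))) * E (l - Suc j) j"
        unfolding X_def Y_def distrib_right by simp
      also have "\<dots> = 0"
        unfolding rc_coeff_telescope[OF \<open>j < l\<close> assms(3,4)] by simp
      finally show "X j + Y (Suc j) = 0" .
    qed
    finally show ?thesis .
  qed
  also have "(\<Sum>j\<le>l. ?R j * (E (Suc (l - j)) j + E (l - j) (Suc j))) = deriv (RC k1 k2 l f) z"
    using DERIV_imp_deriv[OF DERIV_RC[OF assms(1,2,5)]] by (simp add: E_def)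
  finally show ?thesis
    unfolding dvarpi_eq[of _ _ _ z] RC_eq[of _ _ _ f z] E_def K_def P_def Q_def
    by (simp only: mult_zero_right add_0_right)
qed

section \<open>The covariance theorem\<close>

theorem corollary1:
  fixes k1 k2 l :: nat and D :: "complex set"
  assumes "k1 \<ge> 1" and "k2 \<ge> 1" and "open D"
  shows "RC k1 k2 l \<in> hol2 (D \<times> D) \<rightarrow> hol D
    \<and> (\<forall>g\<in>SL2. Some ` D \<subseteq> moebius_sphere g ` Some ` D \<longrightarrow>
          varpi (k1 + k2 + 2 * l) g \<in> hol D \<rightarrow> hol D
        \<and> (varpi k1 g \<boxtimes> varpi k2 g) \<in> hol2 (D \<times> D) \<rightarrow> hol2 (D \<times> D)
        \<and> (\<forall>f\<in>hol2 (D \<times> D). \<forall>z\<in>D.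
              (varpi (k1 + k2 + 2 * l) g \<circ> RC k1 k2 l) f z
                = (RC k1 k2 l \<circ> (varpi k1 g \<boxtimes> varpi k2 g)) f z))
    \<and> (\<forall>Z\<in>sl2.
          dvarpi (k1 + k2 + 2 * l) Z \<in> hol D \<rightarrow> hol D
        \<and> (dvarpi k1 Z \<boxtimes> id) \<in> hol2 (D \<times> D) \<rightarrow> hol2 (D \<times> D)
        \<and> (id \<boxtimes> dvarpi k2 Z) \<in> hol2 (D \<times> D) \<rightarrow> hol2 (D \<times> D)
        \<and> (\<forall>f\<in>hol2 (D \<times> D). \<forall>z\<in>D.
              (dvarpi (k1 + k2 + 2 * l) Z \<circ> RC k1 k2 l) f z
                = (RC k1 k2 l \<circ> (\<lambda>f p. (dvarpi k1 Z \<boxtimes> id) f p + (id \<boxtimes> dvarpi k2 Z) f p)) f z))"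
  unfolding hol2_eq_sep_hol[OF assms(3,3)] hol_def o_apply
proof (intro conjI ballI impI)
  fix g assume g: "g \<in> SL2" "Some ` D \<subseteq> moebius_sphere g ` Some ` D"
  note c = inverse_preserves_if_subset[OF this]
  show "varpi (k1 + k2 + 2 * l) g \<in> {f. f holomorphic_on D} \<rightarrow> {f. f holomorphic_on D}"
    using holomorphic_varpi[OF g(1) c] by simp
  show "(varpi k1 g \<boxtimes> varpi k2 g) \<in> sep_hol D D \<rightarrow> sep_hol D D"
    using sep_hol_boxtimes_varpi[OF assms(3) g(1) c] by simp
  show "varpi (k1 + k2 + 2 * l) g (RC k1 k2 l f) z = RC k1 k2 l ((varpi k1 g \<boxtimes> varpi k2 g) f) z"
    if "f \<in> sep_hol D D" "z \<in> D" for f z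
    using RC_varpi[OF assms(3) g(1) c that(1) assms(1,2) that(2)] by simp
qed (use assms in \<open>simp_all add: holomorphic_RC holomorphic_dvarpi sep_hol_boxtimes_dvarpi1
    sep_hol_boxtimes_dvarpi2 RC_dvarpi\<close>)

end
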